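(* Let $G$ be a finite simple graph with at least one edge. Then: (1) $\operatorname{v}(I(G)^{(2)})=\min\{|S|+1+p(S)\mid S\text{ is a v-witness of }G\}$. (2) $\operatorname{v}(I(G)^2)=\min\{\operatorname{v}(I(G)^{(2)}),\ \operatorname{v}(M_2(I(G)))\}$, where $M_2(I(G))=I(G)^{(2)}/I(G)^2$. Hence, $\operatorname{v}(I(G)^2)<\operatorname{v}(I(G)^{(2)})$ if and only if there exist a triangle $T$ of $G$ and a v-witness $S'$ of $G-N_G[T]$ such that: (i) $G$ has no v-witness of size at most $|S'|+1$; and (ii) every v-witness of $G$ of size $|S'|+2$ is a $2$-packing.
   Context: Let $G$ be a simple graph on $V(G)=[n]$ with edge set $E(G)$ and $R=k[x_1,\dots,x_n]$ a standard graded polynomial ring over a field $k$. The edge ideal is $I(G)=(x_ix_j\mid\{i,j\}\in E(G))$. $N_G(s)$ is the set of neighbors of $s$; for $U\subseteq V(G)$, $N_G[U]$ is $U$ together with all vertices adjacent to some vertex of $U$; $G-U$ is the induced subgraph on $V(G)\setminus U$. A subset $S\subseteq V(G)$ is a v-witness of $G$ if both $S$ and $V(G)\setminus N_G[S]$ are independent sets of $G$ (the empty set is independent, and $S=\emptyset$ is allowed). For a v-witness $S$, put $p(S)=1$ if the sets $\{N_G(s)\}_{s\in S}$ are pairwise disjoint, and $p(S)=0$ otherwise. A v-witness $S$ with $\{N_G(s)\}_{s\in S}$ pairwise disjoint is called a $2$-packing. The $t$-th symbolic power of $I$ is $I^{(t)}=\bigcap_{P\in \operatorname{Ass}(R/I)}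 (I^tR_P\cap R)$. For a finitely generated graded $R$-module $M$ and $P\in\operatorname{Ass}(M)$, $\operatorname{v}_P(M)=\min\{\deg m\mid m\in M\text{ homogeneous},\ \operatorname{ann}_R(m)=P\}$, and $\operatorname{v}(M)=\min\{\operatorname{v}_P(M)\mid P\in\operatorname{Ass}(M)\}$, with $\operatorname{v}(0)=\infty$ for the zero module. For a graded ideal $J$, $\operatorname{v}(J)$ means $\operatorname{v}(R/J)$. *)

theory Defs
  imports
    "HOL-Library.Poly_Mapping"
    "HOL-Library.Extended_Nat"
    "HOL-Library.Disjoint_Sets"
    "HOL-Algebra.Algebra"
    "HOL-Algebra.Algebraic_Closure_Type"
begin

section \<open>Finite simple graphs\<close>

record 'v ugraph =
  vertices :: "'v set"
  edges :: "'v set set"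

definition simple_graph :: "'v ugraph \<Rightarrow> bool" where
  "simple_graph G \<longleftrightarrow> finite (vertices G) \<and> (\<forall>e \<in> edges G. e \<subseteq> vertices G \<and> card e = 2)"

definition nbrs :: "'v ugraph \<Rightarrow> 'v \<Rightarrow> 'v set" where
  "nbrs G s = {u \<in> vertices G. {u, s} \<in> edges G}"

definition closed_nbrs :: "'v ugraph \<Rightarrow> 'v set \<Rightarrow> 'v set" where
  "closed_nbrs G U = U \<union> (\<Union>u\<in>U. nbrs G u)"

definition delete_vertices :: "'v ugraph \<Rightarrow> 'v set \<Rightarrow> 'v ugraph" where
  "delete_vertices G U =
     \<lparr>vertices = vertices G - U, edges = {e \<in> edges G. e \<subseteq> vertices G - U}\<rparr>"

definition independent_set :: "'v ugraph \<Rightarrow> 'v set \<Rightarrow> bool" where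
  "independent_set G A \<longleftrightarrow> A \<subseteq> vertices G \<and> (\<forall>u\<in>A. \<forall>w\<in>A. {u, w} \<notin> edges G)"

definition triangle :: "'v ugraph \<Rightarrow> 'v set \<Rightarrow> bool" where
  "triangle G T \<longleftrightarrow> T \<subseteq> vertices G \<and> card T = 3 \<and>
     (\<forall>u\<in>T. \<forall>w\<in>T. u \<noteq> w \<longrightarrow> {u, w} \<in> edges G)"

definition v_witness :: "'v ugraph \<Rightarrow> 'v set \<Rightarrow> bool" where
  "v_witness G S \<longleftrightarrow>
     independent_set G S \<and> independent_set G (vertices G - closed_nbrs G S)"

text \<open>\<^const>\<open>disjoint_family_on\<close> compares the neighbourhoods of distinct members of \<open>S\<close>,
  so two different vertices with the same nonempty neighbourhood are excluded.\<close>

definition p_ind :: "'v ugraph \<Rightarrow> 'v set \<Rightarrow> nat" where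
  "p_ind G S = (if disjoint_family_on (nbrs G) S then 1 else 0)"

definition two_packing :: "'v ugraph \<Rightarrow> 'v set \<Rightarrow> bool" where
  "two_packing G S \<longleftrightarrow> v_witness G S \<and> disjoint_family_on (nbrs G) S"


section \<open>Graded modules, associated primes and the v-number\<close>

record ('r, 'm) graded_module = "('r, 'm) module" +
  homog :: "nat \<Rightarrow> 'm set"  \<comment> \<open>the homogeneous components, each of them containing zero\<close>

definition annihilator :: "('r, 'a) ring_scheme \<Rightarrow> ('r, 'm, 'b) module_scheme \<Rightarrow> 'm \<Rightarrow> 'r set" where
  "annihilator R M m = {r \<in> carrier R. r \<odot>\<^bsub>M\<^esub> m = \<zero>\<^bsub>M\<^esub>}"

definition Ass :: "('r, 'a) ring_scheme \<Rightarrow> ('r, 'm, 'b) module_scheme \<Rightarrow> 'r set set" where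
  "Ass R M = {P. primeideal P R \<and> (\<exists>m \<in> carrier M. annihilator R M m = P)}"

text \<open>A nonempty infimum in \<^typ>\<open>enat\<close> is a minimum, and the infimum of the empty set is
  \<open>\<infinity>\<close>, which is the value of the v-number on the zero module.\<close>

definition v_at :: "('r, 'a) ring_scheme \<Rightarrow> ('r, 'm, 'b) graded_module_scheme \<Rightarrow> 'r set \<Rightarrow> enat" where
  "v_at R M P = Inf {enat d | d m. m \<in> homog M d \<and> annihilator R M m = P}"

definition v_number :: "('r, 'a) ring_scheme \<Rightarrow> ('r, 'm, 'b) graded_module_scheme \<Rightarrow> enat" where
  "v_number R M = (INF P \<in> Ass R M. v_at R M P)"


section \<open>Polynomial rings and quotients of graded ideals\<close>

type_synonym ('v, 'k) mpoly = "('v \<Rightarrow>\<^sub>0 nat) \<Rightarrow>\<^sub>0 'k"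

abbreviation mpoly_ring :: "('v, 'k::field) mpoly ring" where
  "mpoly_ring \<equiv> ring_of_type_algebra"

definition Var :: "'v \<Rightarrow> ('v, 'k::field) mpoly" where
  "Var i = Poly_Mapping.single (Poly_Mapping.single i 1) 1"

definition homogeneous_of_degree :: "nat \<Rightarrow> ('v, 'k::field) mpoly \<Rightarrow> bool" where
  "homogeneous_of_degree d f \<longleftrightarrow>
     (\<forall>a \<in> Poly_Mapping.keys f. (\<Sum>i \<in> Poly_Mapping.keys a. Poly_Mapping.lookup a i) = d)"

text \<open>The graded module \<open>A / B\<close> for graded ideals \<open>B \<subseteq> A\<close>, with cosets as elements. The ring
  multiplication and unit that module records carry along have no meaning here.\<close>

definition ideal_quot ::
    "('v, 'k::field) mpoly set \<Rightarrow> ('v, 'k) mpoly set \<Rightarrow>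
       (('v, 'k) mpoly, ('v, 'k) mpoly set) graded_module" where
  "ideal_quot A B =
     \<lparr>carrier = (\<lambda>a. B +>\<^bsub>mpoly_ring\<^esub> a) ` A,
      monoid.mult = undefined, one = undefined,
      ring.zero = B,
      add = set_add mpoly_ring,
      module.smult = (\<lambda>r C. \<Union>x\<in>C. B +>\<^bsub>mpoly_ring\<^esub> (r * x)),
      homog = (\<lambda>d. (\<lambda>a. B +>\<^bsub>mpoly_ring\<^esub> a) ` {a \<in> A. homogeneous_of_degree d a})\<rparr>"

definition v_number_ideal :: "('v, 'k::field) mpoly set \<Rightarrow> enat" where
  "v_number_ideal J = v_number mpoly_ring (ideal_quot UNIV J)"

definition ideal_power :: "('r, 'a) ring_scheme \<Rightarrow> 'r set \<Rightarrow> nat \<Rightarrow> 'r set" where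
  "ideal_power R I t = I [^]\<^bsub>ideals_set R\<^esub> t"

definition edge_ideal :: "'v ugraph \<Rightarrow> ('v, 'k::field) mpoly set" where
  "edge_ideal G = Idl\<^bsub>mpoly_ring\<^esub> {Var i * Var j | i j. {i, j} \<in> edges G}"


section \<open>Symbolic powers\<close>

text \<open>The fraction \<open>a / s\<close> in the localization of \<open>R\<close> at \<open>P\<close>, as an equivalence class of
  numerator-denominator pairs.\<close>

definition loc_frac :: "('r, 'a) ring_scheme \<Rightarrow> 'r set \<Rightarrow> 'r \<Rightarrow> 'r \<Rightarrow> ('r \<times> 'r) set" where
  "loc_frac R P a s = {(b, t). b \<in> carrier R \<and> t \<in> carrier R - P \<and>
     (\<exists>u \<in> carrier R - P. u \<otimes>\<^bsub>R\<^esub> (a \<otimes>\<^bsub>R\<^esub> t) = u \<otimes>\<^bsub>R\<^esub> (b \<otimes>\<^bsub>R\<^esub> s))}"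

text \<open>The extension of an ideal \<open>J\<close> to the localization consists of the fractions with
  numerator in \<open>J\<close>; contraction is along the canonical map \<open>f \<mapsto> f / 1\<close>.\<close>

definition loc_extension :: "('r, 'a) ring_scheme \<Rightarrow> 'r set \<Rightarrow> 'r set \<Rightarrow> ('r \<times> 'r) set set" where
  "loc_extension R P J = {loc_frac R P a s | a s. a \<in> J \<and> s \<in> carrier R - P}"

definition loc_contraction :: "('r, 'a) ring_scheme \<Rightarrow> 'r set \<Rightarrow> ('r \<times> 'r) set set \<Rightarrow> 'r set" where
  "loc_contraction R P Q = {f \<in> carrier R. loc_frac R P f \<one>\<^bsub>R\<^esub> \<in> Q}"

definition symbolic_power :: "('v, 'k::field) mpoly set \<Rightarrow> nat \<Rightarrow> ('v, 'k) mpoly set" where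
  "symbolic_power I t =
     (\<Inter>P \<in> Ass mpoly_ring (ideal_quot UNIV I).
        loc_contraction mpoly_ring P (loc_extension mpoly_ring P (ideal_power mpoly_ring I t)))"

end

theory Submission
  imports Defs
begin

text \<open>All ideals involved are monomial, and for a monomial ideal \<open>J\<close> a homogeneous \<open>f\<close> whose colon ideal
  \<open>J : f\<close> is prime has a term \<open>u\<close> with \<open>J : u\<close> generated by the variables in \<open>J : f\<close>. So the
  v-numbers can be computed on monomials.

  For \<open>I\<^sup>(\<^sup>2\<^sup>)\<close> the colon ideal of \<open>x\<^sup>a\<close> is prime iff exactly one maximal independent set \<open>W\<close> has
  total exponent at most one outside \<open>W\<close>, and this exponent is one. Removing the single vertex \<open>c\<close> of
  the support outside \<open>W\<close> leaves a v-witness \<open>S\<close>. Conversely, for a v-witness \<open>S\<close> take the product of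
  the variables in \<open>S \<union> {c}\<close>, with \<open>c\<close> a common neighbour of two elements of \<open>S\<close>; if \<open>S\<close> is a
  2-packing there is no such \<open>c\<close>, and a neighbour \<open>c\<close> of one \<open>s\<close> in \<open>S\<close>, with \<open>s\<close> taken twice, does
  the job. These monomials have the same colon ideal with respect to \<open>I\<^sup>2\<close>.

  The monomials in \<open>I\<^sup>(\<^sup>2\<^sup>)\<close> but not in \<open>I\<^sup>2\<close> are supported on a triangle \<open>T\<close> and an independent set
  outside \<open>N[T]\<close>; such a monomial has a prime colon ideal iff that set is a v-witness of \<open>G - N[T]\<close>.\<close>

abbreviation lookup where "lookup \<equiv> Poly_Mapping.lookup"
abbreviation keys where "keys \<equiv> Poly_Mapping.keys"

definition expvar :: "'v \<Rightarrow> 'v \<Rightarrow>\<^sub>0 nat" where "expvar i = Poly_Mapping.single i 1"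

lemma lookup_expvar [simp]: "lookup (expvar i) x = of_bool (x = i)"
  by (simp add: expvar_def lookup_single when_def)

lemma Var_eq: "Var i = Poly_Mapping.single (expvar i) 1"
  by (simp add: Var_def expvar_def)

section \<open>Supports of products of polynomials\<close>

text \<open>The coefficient at \<open>a + b\<close> is a sum over all representations by terms of
  \<open>f\<close> and \<open>g\<close>; only one can be nonzero, so no cancellation occurs.\<close>

lemma lookup_mult_unique:
  fixes f g :: "'a::cancel_comm_monoid_add \<Rightarrow>\<^sub>0 'b::semiring_0"
  assumes "\<And>a' b'. a' \<in> keys f \<Longrightarrow> b' \<in> keys g \<Longrightarrow> a' + b' = a + b \<Longrightarrow> a' = a \<and> b' = b"
  shows "lookup (f * g) (a + b) = lookup f a * lookup g b"
proof -
  have "lookup f l * (\<Sum>q. lookup g q when a + b = l + q) = (lookup f a * lookup g b when l = a)" for l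
  proof (cases "l = a")
    case True
    then show ?thesis by simp
  next
    case False
    have "lookup f l = 0 \<or> (\<forall>q. (lookup g q when a + b = l + q) = 0)"
    proof (rule ccontr)
      assume "\<not> ?thesis"
      then obtain q where "lookup f l \<noteq> 0" "(lookup g q when a + b = l + q) \<noteq> 0" by blast
      then have "l \<in> keys f" "q \<in> keys g" "l + q = a + b"
        by (auto simp: in_keys_iff when_def split: if_splits)
      with assms False show False by blast
    qed
    with False show ?thesis by auto
  qed
  then show ?thesis by (simp add: lookup_mult)
qed

text \<open>Each step of the induction passes to the faces of the two sets on which one more
  coordinate is maximal; this replaces a monomial order.\<close>

lemma unique_sum_pair:
  fixes A B :: "('v::finite \<Rightarrow>\<^sub>0 nat) set"
  assumes "finite A" "A \<noteq> {}" "finite B" "B \<noteq> {}"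
  obtains a b where "a \<in> A" "b \<in> B"
    "\<And>a' b'. a' \<in> A \<Longrightarrow> b' \<in> B \<Longrightarrow> a' + b' = a + b \<Longrightarrow> a' = a \<and> b' = b"
proof -
  \<comment> \<open>\<open>A'\<close> and \<open>B'\<close> contain every representation of each of
    their sums, and all coordinates in \<open>W\<close> are constant on each of them. For
    \<open>W = UNIV\<close> both are singletons, which yields the unique pair.\<close>
  define face where "face W A' B' \<longleftrightarrow> A' \<subseteq> A \<and> B' \<subseteq> B \<and> A' \<noteq> {} \<and> B' \<noteq> {} \<and>
      (\<forall>i\<in>W. \<exists>m. \<forall>a\<in>A'. lookup a i = m) \<and> (\<forall>i\<in>W. \<exists>m. \<forall>b\<in>B'. lookup b i = m) \<and>
      (\<forall>a\<in>A'. \<forall>b\<in>B'. \<forall>a'\<in>A. \<forall>b'\<in>B. a' + b' = a + b \<longrightarrow> a' \<in> A' \<and> b' \<in> B')"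
    for W :: "'v set" and A' B'
  have "\<exists>A' B'. face W A' B'" if "finite W" for W :: "'v set"
    using that
  proof (induction W)
    case empty
    show ?case
      using assms by (intro exI[of _ A] exI[of _ B]) (auto simp: face_def)
  next
    case (insert i W)
    then obtain A' B' where "face W A' B'" by blast
    then have AB: "A' \<subseteq> A" "B' \<subseteq> B" "A' \<noteq> {}" "B' \<noteq> {}"
      and cA: "\<forall>i\<in>W. \<exists>m. \<forall>a\<in>A'. lookup a i = m" and cB: "\<forall>i\<in>W. \<exists>m. \<forall>b\<in>B'. lookup b i = m"
      and face: "\<And>a b a' b'. a\<in>A' \<Longrightarrow> b\<in>B' \<Longrightarrow> a'\<in>A \<Longrightarrow> b'\<in>B \<Longrightarrow> a' + b' = a + b \<Longrightarrow> a' \<in> A' \<and> b' \<in> B'"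
      unfolding face_def by blast+
    have fin: "finite A'" "finite B'" using AB assms finite_subset by auto
    define m where "m = Max ((\<lambda>a. lookup a i) ` A')"
    define n where "n = Max ((\<lambda>b. lookup b i) ` B')"
    define A'' where "A'' = {a \<in> A'. lookup a i = m}"
    define B'' where "B'' = {b \<in> B'. lookup b i = n}"
    have m: "m \<in> (\<lambda>a. lookup a i) ` A'" "\<And>a. a \<in> A' \<Longrightarrow> lookup a i \<le> m"
      unfolding m_def using fin AB by (auto intro!: Max_in)
    have n: "n \<in> (\<lambda>a. lookup a i) ` B'" "\<And>a. a \<in> B' \<Longrightarrow> lookup a i \<le> n"
      unfolding n_def using fin AB by (auto intro!: Max_in)
    have ne: "A'' \<noteq> {}" "B'' \<noteq> {}" using m(1) n(1) by (auto simp: A''_def B''_def)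
    have face': "a' \<in> A'' \<and> b' \<in> B''"
      if "a \<in> A''" "b \<in> B''" "a' \<in> A" "b' \<in> B" "a' + b' = a + b" for a b a' b'
    proof -
      have *: "a' \<in> A' \<and> b' \<in> B'" using face that by (auto simp: A''_def B''_def)
      have "lookup a' i + lookup b' i = lookup a i + lookup b i"
        using that(5) by (metis lookup_add)
      then have "lookup a' i + lookup b' i = m + n" using that by (simp add: A''_def B''_def)
      with m(2)[of a'] n(2)[of b'] * have "lookup a' i = m" "lookup b' i = n" by linarith+
      with * show ?thesis by (simp add: A''_def B''_def)
    qed
    have sub: "A'' \<subseteq> A'" "B'' \<subseteq> B'" by (auto simp: A''_def B''_def)
    have cA'': "\<forall>j\<in>insert i W. \<exists>m. \<forall>a\<in>A''. lookup a j = m"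
      using cA sub by (simp add: A''_def) blast
    have cB'': "\<forall>j\<in>insert i W. \<exists>m. \<forall>b\<in>B''. lookup b j = m"
      using cB sub by (simp add: B''_def) blast
    show ?case
      unfolding face_def
    proof (intro exI conjI)
      show "A'' \<subseteq> A" "B'' \<subseteq> B" using sub AB by auto
      show "\<forall>a\<in>A''. \<forall>b\<in>B''. \<forall>a'\<in>A. \<forall>b'\<in>B. a' + b' = a + b \<longrightarrow> a' \<in> A'' \<and> b' \<in> B''"
        using face' by blast
    qed (use ne cA'' cB'' in auto)
  qed
  from this[OF finite] obtain A' B' where "face UNIV A' B'" by blast
  then have AB: "A' \<subseteq> A" "B' \<subseteq> B" "A' \<noteq> {}" "B' \<noteq> {}"
    and cA: "\<forall>i. \<exists>m. \<forall>a\<in>A'. lookup a i = m" and cB: "\<forall>i. \<exists>m. \<forall>b\<in>B'. lookup b i = m"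
    and face: "\<And>a b a' b'. a\<in>A' \<Longrightarrow> b\<in>B' \<Longrightarrow> a'\<in>A \<Longrightarrow> b'\<in>B \<Longrightarrow> a' + b' = a + b \<Longrightarrow> a' \<in> A' \<and> b' \<in> B'"
    unfolding face_def by blast+
  from AB obtain a b where ab: "a \<in> A'" "b \<in> B'" by blast
  have "a' = a" if "a' \<in> A'" for a'
    using cA that ab(1) by (metis poly_mapping_eqI)
  moreover have "b' = b" if "b' \<in> B'" for b'
    using cB that ab(2) by (metis poly_mapping_eqI)
  ultimately show thesis
    using that[of a b] ab AB face by blast
qed

text \<open>The largest power of the prime generated by the variables in \<open>C\<close> that
  contains the monomial with exponent \<open>a\<close>.\<close>

definition cdeg :: "'v::finite set \<Rightarrow> ('v \<Rightarrow>\<^sub>0 nat) \<Rightarrow> nat" where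
  "cdeg C a = (\<Sum>i\<in>C. lookup a i)"

lemma cdeg_add [simp]: "cdeg C (a + b) = cdeg C a + cdeg C b"
  by (simp add: cdeg_def lookup_add sum.distrib)

lemma cdeg_expvar [simp]: "cdeg C (expvar i) = of_bool (i \<in> C)"
  by (simp add: cdeg_def)

lemma cdeg_eq_0_iff: "cdeg C a = 0 \<longleftrightarrow> (\<forall>i\<in>C. lookup a i = 0)"
  by (simp add: cdeg_def)

text \<open>The part of \<open>f\<close> of lowest degree in \<open>C\<close> times the part of
  \<open>g\<close> of degree zero in \<open>C\<close> does not vanish. With \<open>d = 1\<close>
  this gives primality of \<open>var_ideal C\<close>, with \<open>d = 2\<close> the contraction of
  the localized square.\<close>

lemma cdeg_cancel:
  fixes f g :: "('v::finite, 'k::field) mpoly"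
  assumes prod: "\<And>k. k \<in> keys (f * g) \<Longrightarrow> d \<le> cdeg C k"
    and b0: "b0 \<in> keys g" "cdeg C b0 = 0" and a0: "a0 \<in> keys f"
  shows "d \<le> cdeg C a0"
proof (rule ccontr)
  assume less: "\<not> ?thesis"
  define m where "m = Min (cdeg C ` keys f)"
  have m: "m \<in> cdeg C ` keys f" "\<And>a. a \<in> keys f \<Longrightarrow> m \<le> cdeg C a"
    unfolding m_def using a0 by (auto intro!: Min_in)
  have "m < d" using m(2)[OF a0] less by simp
  obtain a b where ab: "a \<in> {a \<in> keys f. cdeg C a = m}" "b \<in> {b \<in> keys g. cdeg C b = 0}"
    and uniq: "\<And>a' b'. a' \<in> {a \<in> keys f. cdeg C a = m} \<Longrightarrow> b' \<in> {b \<in> keys g. cdeg C b = 0} \<Longrightarrow>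
      a' + b' = a + b \<Longrightarrow> a' = a \<and> b' = b"
    by (rule unique_sum_pair[of "{a \<in> keys f. cdeg C a = m}" "{b \<in> keys g. cdeg C b = 0}"])
      (use m(1) b0 in auto)
  have "lookup (f * g) (a + b) = lookup f a * lookup g b"
  proof (rule lookup_mult_unique)
    fix a' b' assume *: "a' \<in> keys f" "b' \<in> keys g" "a' + b' = a + b"
    \<comment> \<open>The total is already the minimal one, so any other representation of
      \<open>a + b\<close> also uses only terms of the two lowest parts.\<close>
    then have "cdeg C a' + cdeg C b' = m"
      using ab by (metis (mono_tags, lifting) add.right_neutral cdeg_add mem_Collect_eq)
    with m(2)[OF *(1)] have "cdeg C a' = m" "cdeg C b' = 0" by auto
    with uniq * show "a' = a \<and> b' = b" by blast
  qed
  then have "a + b \<in> keys (f * g)" using ab by (simp add: in_keys_iff)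
  from prod[OF this] ab \<open>m < d\<close> show False by simp
qed

section \<open>Ideals of the ring of a type\<close>

lemma ring_of_type_simps [simp]:
  "carrier ring_of_type_algebra = UNIV"
  "a \<otimes>\<^bsub>ring_of_type_algebra\<^esub> b = a * b"
  "a \<oplus>\<^bsub>ring_of_type_algebra\<^esub> b = a + b"
  "\<one>\<^bsub>ring_of_type_algebra\<^esub> = 1"
  "\<zero>\<^bsub>ring_of_type_algebra\<^esub> = 0"
  by (simp_all add: ring_of_type_algebra_def)

lemma ideal_of_type_iff:
  fixes J :: "'a::comm_ring_1 set"
  shows "ideal J ring_of_type_algebra \<longleftrightarrow>
    0 \<in> J \<and> (\<forall>a\<in>J. \<forall>b\<in>J. a + b \<in> J) \<and> (\<forall>a\<in>J. \<forall>r. r * a \<in> J)" (is "_ \<longleftrightarrow> ?R")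
proof
  assume "ideal J ring_of_type_algebra"
  then interpret ideal J "ring_of_type_algebra :: 'a ring" .
  show ?R
    using additive_subgroup.zero_closed[OF is_additive_subgroup]
      additive_subgroup.a_closed[OF is_additive_subgroup] I_l_closed by auto
next
  assume R: ?R
  interpret cring "ring_of_type_algebra :: 'a ring" by (rule cring_from_type_algebra)
  show "ideal J ring_of_type_algebra"
  proof (rule idealI)
    show "Ring.ring (ring_of_type_algebra :: 'a ring)" by (rule ring_from_type_algebra)
    show "subgroup J (add_monoid (ring_of_type_algebra :: 'a ring))"
    proof (rule add.subgroupI)
      fix a assume "a \<in> J"
      then have "- 1 * a \<in> J" using R by blast
      moreover have "\<ominus>\<^bsub>ring_of_type_algebra\<^esub> a = - a"
        by (rule minus_equality) auto
      ultimately show "\<ominus>\<^bsub>ring_of_type_algebra\<^esub> a \<in> J" by simp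
    qed (use R in auto)
  qed (use R in \<open>auto simp: mult.commute\<close>)
qed

lemma primeideal_of_type_iff:
  fixes P :: "'a::comm_ring_1 set"
  shows "primeideal P ring_of_type_algebra \<longleftrightarrow>
    ideal P ring_of_type_algebra \<and> P \<noteq> UNIV \<and> (\<forall>a b. a * b \<in> P \<longrightarrow> a \<in> P \<or> b \<in> P)" (is "_ \<longleftrightarrow> ?R")
proof
  assume "primeideal P ring_of_type_algebra"
  then interpret primeideal P "ring_of_type_algebra :: 'a ring" .
  show ?R
    using ideal_axioms I_notcarr I_prime by auto
next
  assume ?R
  then show "primeideal P ring_of_type_algebra"
    by (intro primeidealI cring_from_type_algebra) auto
qed

lemma r_coset_of_type: "J +>\<^bsub>ring_of_type_algebra\<^esub> a = (\<lambda>j. j + a) ` J"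
  by (auto simp: a_r_coset_def' ring_of_type_algebra_def)

lemma r_coset_of_type_eq_iff:
  fixes J :: "'a::comm_ring_1 set"
  assumes "ideal J ring_of_type_algebra"
  shows "J +>\<^bsub>ring_of_type_algebra\<^esub> a = J +>\<^bsub>ring_of_type_algebra\<^esub> b \<longleftrightarrow> a - b \<in> J"
proof -
  have J: "0 \<in> J" "\<And>a b. a \<in> J \<Longrightarrow> b \<in> J \<Longrightarrow> a + b \<in> J" "\<And>r a. a \<in> J \<Longrightarrow> r * a \<in> J"
    using assms by (auto simp: ideal_of_type_iff)
  have neg: "- a \<in> J" if "a \<in> J" for a using J(3)[OF that, of "- 1"] by simp
  have sub: "(\<lambda>j. j + a) ` J \<subseteq> (\<lambda>j. j + b) ` J" if "a - b \<in> J" for a b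
  proof
    fix x assume "x \<in> (\<lambda>j. j + a) ` J"
    then obtain j where "j \<in> J" "x = j + a" by blast
    then show "x \<in> (\<lambda>j. j + b) ` J"
      using J(2)[OF \<open>j \<in> J\<close> that] by (intro image_eqI[of _ _ "j + (a - b)"]) auto
  qed
  show ?thesis
    unfolding r_coset_of_type
  proof
    assume "(\<lambda>j. j + a) ` J = (\<lambda>j. j + b) ` J"
    then have "0 + a \<in> (\<lambda>j. j + b) ` J" using J(1) by blast
    then show "a - b \<in> J" by auto
  next
    assume "a - b \<in> J"
    with sub[of a b] sub[of b a] neg[of "a - b"] show "(\<lambda>j. j + a) ` J = (\<lambda>j. j + b) ` J" by auto
  qed
qed

section \<open>Annihilators, associated primes and v-numbers of quotients by an ideal\<close>

lemma annihilator_coset: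
  fixes B :: "('v, 'k::field) mpoly set"
  assumes "ideal B mpoly_ring"
  shows "annihilator mpoly_ring (ideal_quot A B) (B +>\<^bsub>mpoly_ring\<^esub> f) = {r. r * f \<in> B}"
proof -
  have B: "0 \<in> B" "\<And>r a. a \<in> B \<Longrightarrow> r * a \<in> B"
    using assms by (auto simp: ideal_of_type_iff)
  \<comment> \<open>All cosets in the union that defines scalar multiplication coincide, so the
    union is a single coset.\<close>
  have "(\<Union>x\<in>B +>\<^bsub>mpoly_ring\<^esub> f. B +>\<^bsub>mpoly_ring\<^esub> (r * x)) = B +>\<^bsub>mpoly_ring\<^esub> (r * f)" for r
  proof -
    have "B +>\<^bsub>mpoly_ring\<^esub> (r * x) = B +>\<^bsub>mpoly_ring\<^esub> (r * f)" if "x \<in> B +>\<^bsub>mpoly_ring\<^esub> f" for x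
      using that B by (auto simp: r_coset_of_type r_coset_of_type_eq_iff[OF assms, unfolded r_coset_of_type]
          algebra_simps)
    moreover have "f \<in> B +>\<^bsub>mpoly_ring\<^esub> f" using B by (force simp: r_coset_of_type)
    ultimately show ?thesis by blast
  qed
  moreover have "B +>\<^bsub>mpoly_ring\<^esub> (r * f) = B \<longleftrightarrow> r * f \<in> B" for r
    using r_coset_of_type_eq_iff[OF assms, of "r * f" 0] by (simp add: r_coset_of_type)
  ultimately show ?thesis
    by (simp add: annihilator_def ideal_quot_def)
qed

lemma Ass_ideal_quot:
  fixes B :: "('v, 'k::field) mpoly set"
  assumes "ideal B mpoly_ring"
  shows "Ass mpoly_ring (ideal_quot A B) = {P. primeideal P mpoly_ring \<and> (\<exists>f\<in>A. P = {r. r * f \<in> B})}"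
proof -
  have "carrier (ideal_quot A B) = (\<lambda>a. B +>\<^bsub>mpoly_ring\<^esub> a) ` A" by (simp add: ideal_quot_def)
  then show ?thesis
    unfolding Ass_def by (auto simp: annihilator_coset[OF assms])
qed

text \<open>The annihilator of the class of \<open>f\<close> is the colon ideal of \<open>f\<close>,
  so the prime is determined by \<open>f\<close> and the nested infima over primes and degrees merge
  into one over homogeneous representatives.\<close>

lemma v_number_ideal_quot:
  fixes B :: "('v, 'k::field) mpoly set"
  assumes "ideal B mpoly_ring"
  shows "v_number mpoly_ring (ideal_quot A B) = Inf {enat d | d f. f \<in> A \<and>
    homogeneous_of_degree d f \<and> primeideal {r. r * f \<in> B} mpoly_ring}" (is "_ = Inf ?X")
proof -
  have homog: "homog (ideal_quot A B) d = (\<lambda>a. B +>\<^bsub>mpoly_ring\<^esub> a) ` {a \<in> A. homogeneous_of_degree d a}" for d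
    by (simp add: ideal_quot_def)
  show ?thesis
  proof (rule antisym)
    show "v_number mpoly_ring (ideal_quot A B) \<le> Inf ?X"
    proof (rule Inf_greatest)
      fix x assume "x \<in> ?X"
      then obtain d f where x: "x = enat d" "f \<in> A" "homogeneous_of_degree d f"
        "primeideal {r. r * f \<in> B} mpoly_ring" by blast
      show "v_number mpoly_ring (ideal_quot A B) \<le> x"
        unfolding v_number_def
      proof (rule INF_lower2)
        show "{r. r * f \<in> B} \<in> Ass mpoly_ring (ideal_quot A B)"
          using x by (auto simp: Ass_ideal_quot[OF assms])
        show "v_at mpoly_ring (ideal_quot A B) {r. r * f \<in> B} \<le> x"
          unfolding v_at_def using x annihilator_coset[OF assms, of A f]
          by (intro Inf_lower) (auto simp: homog)
      qed
    qed
    show "Inf ?X \<le> v_number mpoly_ring (ideal_quot A B)"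
      unfolding v_number_def v_at_def
    proof (intro INF_greatest Inf_greatest, clarify)
      fix P d m assume P: "annihilator mpoly_ring (ideal_quot A B) m \<in> Ass mpoly_ring (ideal_quot A B)"
        and m: "m \<in> homog (ideal_quot A B) d"
      from m obtain f where "f \<in> A" "homogeneous_of_degree d f" "m = B +>\<^bsub>mpoly_ring\<^esub> f"
        by (auto simp: homog)
      then show "Inf ?X \<le> enat d"
        using P by (intro Inf_lower) (auto simp: annihilator_coset[OF assms] Ass_def)
    qed
  qed
qed

section \<open>Monomial ideals\<close>

definition monomial_ideal :: "('v \<Rightarrow>\<^sub>0 nat) set \<Rightarrow> ('v, 'k::field) mpoly set" where
  "monomial_ideal M = {f. keys f \<subseteq> M}"

definition up_closed :: "('v \<Rightarrow>\<^sub>0 nat) set \<Rightarrow> bool" where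
  "up_closed M \<longleftrightarrow> (\<forall>a\<in>M. \<forall>b. a + b \<in> M)"

text \<open>For an up-closed set of exponents this says that the monomial with exponent \<open>a\<close> has a
  prime annihilator modulo the monomial ideal, generated by the variables in it.\<close>

definition vprime :: "('v \<Rightarrow>\<^sub>0 nat) set \<Rightarrow> ('v \<Rightarrow>\<^sub>0 nat) \<Rightarrow> bool" where
  "vprime M a \<longleftrightarrow> a \<notin> M \<and> (\<forall>b. a + b \<in> M \<longrightarrow> (\<exists>i. lookup b i \<noteq> 0 \<and> a + expvar i \<in> M))"

text \<open>The ideal generated by the variables in \<open>C\<close>, given through its monomials so
  that membership becomes a condition on degrees in \<open>C\<close>.\<close>

definition var_ideal :: "'v::finite set \<Rightarrow> ('v, 'k::field) mpoly set" where
  "var_ideal C = monomial_ideal {k. cdeg C k \<noteq> 0}"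

lemma monomial_ideal_UNIV [simp]: "monomial_ideal UNIV = UNIV"
  by (simp add: monomial_ideal_def)

lemma single_mem_monomial_ideal [simp]: "Poly_Mapping.single a 1 \<in> monomial_ideal M \<longleftrightarrow> a \<in> M"
  by (simp add: monomial_ideal_def)

lemma ideal_monomial_ideal:
  assumes "up_closed M"
  shows "ideal (monomial_ideal M :: ('v, 'k::field) mpoly set) mpoly_ring"
  unfolding ideal_of_type_iff
proof (intro conjI ballI allI)
  fix f g :: "('v, 'k) mpoly" assume "f \<in> monomial_ideal M"
  then have f: "keys f \<subseteq> M" by (simp add: monomial_ideal_def)
  { assume "g \<in> monomial_ideal M"
    with f show "f + g \<in> monomial_ideal M"
      using keys_add[of f g] by (auto simp: monomial_ideal_def) }
  show "g * f \<in> monomial_ideal M"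
    unfolding monomial_ideal_def
  proof (intro CollectI subsetI)
    fix k assume "k \<in> keys (g * f)"
    then obtain a b where "k = a + b" "b \<in> keys f" using keys_mult[of g f] by blast
    with f assms show "k \<in> M" by (metis add.commute subsetD up_closed_def)
  qed
qed (simp add: monomial_ideal_def)

lemma sum_single_keys: "(\<Sum>a\<in>keys f. Poly_Mapping.single a (lookup f a)) = f"
proof (rule poly_mapping_eqI)
  fix k
  show "lookup (\<Sum>a\<in>keys f. Poly_Mapping.single a (lookup f a)) k = lookup f k"
    by (simp add: lookup_sum lookup_single when_def in_keys_iff)
qed

lemma sum_mem_ideal:
  fixes J :: "'a::comm_ring_1 set"
  assumes "ideal J ring_of_type_algebra" and "\<And>x. x \<in> U \<Longrightarrow> g x \<in> J"
  shows "(\<Sum>x\<in>U. g x) \<in> J"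
  using assms(2)
  by (induction U rule: infinite_finite_induct) (use assms(1) in \<open>auto simp: ideal_of_type_iff\<close>)

lemma monomial_ideal_subset:
  fixes J :: "('v, 'k::field) mpoly set"
  assumes J: "ideal J mpoly_ring" and M: "\<And>a. a \<in> M \<Longrightarrow> Poly_Mapping.single a 1 \<in> J"
  shows "monomial_ideal M \<subseteq> J"
proof
  fix f :: "('v, 'k) mpoly" assume "f \<in> monomial_ideal M"
  then have f: "keys f \<subseteq> M" by (simp add: monomial_ideal_def)
  have "Poly_Mapping.single a (lookup f a) \<in> J" if "a \<in> keys f" for a
  proof -
    have "Poly_Mapping.single 0 (lookup f a) * Poly_Mapping.single a 1 \<in> J"
      using J M that f by (auto simp: ideal_of_type_iff)
    then show ?thesis by (simp add: mult_single)
  qed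
  then have "(\<Sum>a\<in>keys f. Poly_Mapping.single a (lookup f a)) \<in> J"
    by (rule sum_mem_ideal[OF J])
  then show "f \<in> J" by (simp add: sum_single_keys)
qed

lemma lookup_mult_monomial:
  "lookup (f * Poly_Mapping.single a 1) (k + a) = lookup f k"
  for f :: "('v, 'k::field) mpoly"
  by (subst lookup_mult_unique) auto

lemma mult_monomial_mem_iff:
  fixes r :: "('v, 'k::field) mpoly"
  shows "r * Poly_Mapping.single a 1 \<in> monomial_ideal M \<longleftrightarrow> (\<forall>k\<in>keys r. k + a \<in> M)"
proof
  assume "r * Poly_Mapping.single a 1 \<in> monomial_ideal M"
  then show "\<forall>k\<in>keys r. k + a \<in> M"
    using lookup_mult_monomial[of r a] by (auto simp: monomial_ideal_def in_keys_iff subset_iff)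
next
  assume "\<forall>k\<in>keys r. k + a \<in> M"
  then show "r * Poly_Mapping.single a 1 \<in> monomial_ideal M"
    using keys_mult[of r "Poly_Mapping.single a 1"] by (auto simp: monomial_ideal_def)
qed

lemma mem_var_ideal_iff: "f \<in> var_ideal C \<longleftrightarrow> (\<forall>k\<in>keys f. cdeg C k \<noteq> 0)"
  by (auto simp: var_ideal_def monomial_ideal_def)

text \<open>If \<open>g\<close> has a term free of the variables in \<open>C\<close>, then
  \<open>cdeg_cancel\<close> with bound one puts a variable of \<open>C\<close> into every term of
  \<open>f\<close>.\<close>

lemma primeideal_var_ideal: "primeideal (var_ideal C :: ('v::finite, 'k::field) mpoly set) mpoly_ring"
  unfolding primeideal_of_type_iff
proof (intro conjI allI impI)
  show "ideal (var_ideal C :: ('v, 'k) mpoly set) mpoly_ring"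
    unfolding var_ideal_def by (rule ideal_monomial_ideal) (simp add: up_closed_def)
  have "(1 :: ('v, 'k) mpoly) \<notin> var_ideal C"
    by (simp add: mem_var_ideal_iff cdeg_def flip: single_one)
  then show "(var_ideal C :: ('v, 'k) mpoly set) \<noteq> UNIV" by auto
  fix f g :: "('v, 'k) mpoly" assume fg: "f * g \<in> var_ideal C"
  show "f \<in> var_ideal C \<or> g \<in> var_ideal C"
  proof (rule disjCI)
    assume "g \<notin> var_ideal C"
    then obtain b where b: "b \<in> keys g" "cdeg C b = 0" by (auto simp: mem_var_ideal_iff)
    have "1 \<le> cdeg C a" if "a \<in> keys f" for a
      using fg by (intro cdeg_cancel[OF _ b that]) (auto simp: mem_var_ideal_iff Suc_le_eq)
    then show "f \<in> var_ideal C" by (fastforce simp: mem_var_ideal_iff)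
  qed
qed

section \<open>Prime colon ideals modulo a monomial ideal\<close>

lemma exponent_split:
  fixes k :: "'v \<Rightarrow>\<^sub>0 nat"
  assumes "lookup k i \<noteq> 0"
  shows "k = expvar i + (k - expvar i)"
  using assms by (intro poly_mapping_eqI) (auto simp: lookup_add lookup_minus)

text \<open>The colon ideal of a monomial is monomial. By \<open>vprime\<close> each of its
  monomials is divisible by a variable in it, and up-closedness gives the converse.\<close>

lemma colon_monomial_eq_var_ideal:
  assumes "up_closed M" "vprime M a"
  shows "{r :: ('v::finite, 'k::field) mpoly. r * Poly_Mapping.single a 1 \<in> monomial_ideal M}
    = var_ideal {i. a + expvar i \<in> M}"
proof -
  have "k + a \<in> M \<longleftrightarrow> cdeg {i. a + expvar i \<in> M} k \<noteq> 0" for k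
  proof
    assume "k + a \<in> M"
    then show "cdeg {i. a + expvar i \<in> M} k \<noteq> 0"
      using assms(2) unfolding vprime_def cdeg_eq_0_iff by (auto simp: add.commute)
  next
    assume "cdeg {i. a + expvar i \<in> M} k \<noteq> 0"
    then obtain i where i: "a + expvar i \<in> M" "lookup k i \<noteq> 0" by (auto simp: cdeg_eq_0_iff)
    have "k + a = a + expvar i + (k - expvar i)"
      by (subst exponent_split[OF i(2)]) (simp only: ac_simps)
    with i(1) assms(1) show "k + a \<in> M" by (metis up_closed_def)
  qed
  then show ?thesis by (simp add: mult_monomial_mem_iff mem_var_ideal_iff set_eq_iff)
qed

text \<open>A product of elements of the ideals, each chosen outside \<open>P\<close>, would lie in
  the intersection but not in \<open>P\<close>. This is applied to the colon ideals of the terms of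
  a polynomial and to the minimal primes of the edge ideal.\<close>

lemma primeideal_INT_subset:
  fixes P :: "'a::comm_ring_1 set"
  assumes P: "primeideal P ring_of_type_algebra" and "finite U"
    and "\<And>u. u \<in> U \<Longrightarrow> ideal (J u) ring_of_type_algebra" "(\<Inter>u\<in>U. J u) \<subseteq> P"
  shows "\<exists>u\<in>U. J u \<subseteq> P"
  using assms(2-)
proof (induction U)
  case empty
  then show ?case using P by (auto simp: primeideal_of_type_iff)
next
  case (insert u U)
  show ?case
  proof (rule ccontr)
    assume neg: "\<not> ?thesis"
    then obtain x where x: "x \<in> J u" "x \<notin> P" by blast
    from neg insert have "\<not> (\<Inter>u\<in>U. J u) \<subseteq> P" by blast
    then obtain y where y: "y \<in> (\<Inter>u\<in>U. J u)" "y \<notin> P" by blast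
    have "y * x \<in> J u" "x * y \<in> (\<Inter>u\<in>U. J u)"
      using insert.prems(1) x y by (auto simp: ideal_of_type_iff)
    then have "x * y \<in> P" using insert.prems(2) by (auto simp: mult.commute)
    with x y P show False by (auto simp: primeideal_of_type_iff)
  qed
qed

text \<open>Split off one variable at a time: primality puts it or the remaining monomial into
  \<open>P\<close>, and the process cannot end at the monomial 1.\<close>

lemma Var_mem_of_monomial_mem:
  fixes P :: "('v::finite, 'k::field) mpoly set"
  assumes P: "primeideal P mpoly_ring" and "Poly_Mapping.single b 1 \<in> P"
  shows "\<exists>i. lookup b i \<noteq> 0 \<and> Var i \<in> P"
  using assms(2)
proof (induction "cdeg UNIV b" arbitrary: b)
  case 0
  then have "b = 0" by (intro poly_mapping_eqI) (simp add: cdeg_eq_0_iff)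
  with 0 have "1 \<in> P" by simp
  then have "r * 1 \<in> P" for r using P unfolding primeideal_of_type_iff ideal_of_type_iff by blast
  then have "P = UNIV" by auto
  with P show ?case by (simp add: primeideal_of_type_iff)
next
  case (Suc n)
  then have "cdeg UNIV b \<noteq> 0" by simp
  then obtain i where i: "lookup b i \<noteq> 0" by (auto simp: cdeg_eq_0_iff)
  define c where "c = b - expvar i"
  have b: "b = expvar i + c" unfolding c_def by (rule exponent_split[OF i])
  with Suc b have n: "n = cdeg UNIV c" by simp
  have "Var i * Poly_Mapping.single c 1 \<in> P"
    using Suc(3) by (simp add: Var_eq mult_single b)
  then consider "Var i \<in> P" | "Poly_Mapping.single c 1 \<in> P"
    using P by (auto simp: primeideal_of_type_iff)
  then show ?case
  proof cases
    case 1
    with i show ?thesis by blast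
  next
    case 2
    from Suc(1)[OF n 2] show ?thesis by (auto simp: b lookup_add)
  qed
qed

text \<open>The colon ideal of \<open>f\<close> contains the intersection of the colon ideals of its terms, so it
  contains one of these, which is then generated by the variables in the colon ideal of \<open>f\<close>.\<close>

lemma vprime_of_primeideal_colon:
  fixes f :: "('v::finite, 'k::field) mpoly"
  assumes M: "up_closed M" and P: "primeideal {r. r * f \<in> monomial_ideal M} mpoly_ring"
  shows "\<exists>a\<in>keys f. vprime M a"
proof -
  define P where "P = {r. r * f \<in> monomial_ideal M}"
  note pP = P[folded P_def]
  note idM = ideal_monomial_ideal[OF M, where 'k = 'k]
  define J where "J u = {r. r * Poly_Mapping.single u (1::'k) \<in> monomial_ideal M}" for u
  have "\<exists>u\<in>keys f. J u \<subseteq> P"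
  proof (rule primeideal_INT_subset[OF pP])
    fix u
    show "ideal (J u) mpoly_ring"
      using idM unfolding ideal_of_type_iff J_def by (auto simp: distrib_right mult.assoc)
  next
    show "(\<Inter>u\<in>keys f. J u) \<subseteq> P"
    proof
      fix r assume r: "r \<in> (\<Inter>u\<in>keys f. J u)"
      have "r * Poly_Mapping.single u (lookup f u) \<in> monomial_ideal M" if "u \<in> keys f" for u
      proof -
        have "Poly_Mapping.single 0 (lookup f u) * (r * Poly_Mapping.single u 1) \<in> monomial_ideal M"
          using r that idM unfolding ideal_of_type_iff J_def by blast
        then show ?thesis by (simp add: mult.left_commute mult_single)
      qed
      then have "(\<Sum>u\<in>keys f. r * Poly_Mapping.single u (lookup f u)) \<in> monomial_ideal M"
        by (rule sum_mem_ideal[OF idM])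
      then show "r \<in> P" by (simp add: P_def sum_single_keys flip: sum_distrib_left)
    qed
  qed simp
  then obtain u where u: "u \<in> keys f" "J u \<subseteq> P" by blast
  have "u \<notin> M"
  proof
    assume "u \<in> M"
    then have "r \<in> J u" for r using idM by (auto simp: J_def ideal_of_type_iff)
    with u have "P = UNIV" by blast
    with pP show False by (simp add: primeideal_of_type_iff)
  qed
  moreover have "\<exists>i. lookup b i \<noteq> 0 \<and> u + expvar i \<in> M" if "u + b \<in> M" for b
  proof -
    have "Poly_Mapping.single b 1 \<in> J u" using that by (simp add: J_def mult_single add.commute)
    then obtain i where i: "lookup b i \<noteq> 0" "Var i \<in> P"
      using u Var_mem_of_monomial_mem[OF pP] by blast
    \<comment> \<open>Multiplication by a variable shifts the support injectively, so the term
      \<open>u\<close> of \<open>f\<close> survives in the product, which lies in the monomial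
      ideal.\<close>
    have "lookup (f * Var i) (u + expvar i) = lookup f u"
      unfolding Var_eq by (rule lookup_mult_monomial)
    then have "u + expvar i \<in> keys (Var i * f)" using u by (simp add: in_keys_iff mult.commute)
    with i show ?thesis by (auto simp: P_def monomial_ideal_def)
  qed
  ultimately show ?thesis using u unfolding vprime_def by blast
qed

lemma homogeneous_of_degree_iff: "homogeneous_of_degree d f \<longleftrightarrow> (\<forall>a\<in>keys f. cdeg UNIV a = d)"
  for f :: "('v::finite, 'k::field) mpoly"
proof -
  have "(\<Sum>i\<in>keys a. lookup a i) = cdeg UNIV a" for a :: "'v \<Rightarrow>\<^sub>0 nat"
    unfolding cdeg_def by (rule sum.mono_neutral_left) (auto simp: in_keys_iff)
  then show ?thesis by (simp add: homogeneous_of_degree_def)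
qed

text \<open>A homogeneous \<open>f\<close> with prime colon ideal has a term with
  \<open>vprime\<close>; it has the same degree, and its exponent lies in \<open>A\<close>.
  Conversely such a monomial is itself a homogeneous element with prime colon ideal.\<close>

lemma v_number_monomial_quot:
  assumes M: "up_closed M"
  shows "v_number mpoly_ring (ideal_quot (monomial_ideal A) (monomial_ideal M :: ('v::finite, 'k::field) mpoly set))
    = Inf {enat (cdeg UNIV a) | a. a \<in> A \<and> vprime M a}"
  unfolding v_number_ideal_quot[OF ideal_monomial_ideal[OF M]]
proof (rule arg_cong[of _ _ Inf], intro equalityI subsetI; elim CollectE exE conjE)
  fix x d and f :: "('v, 'k) mpoly"
  assume x: "x = enat d" "f \<in> monomial_ideal A" "homogeneous_of_degree d f"
    "primeideal {r. r * f \<in> monomial_ideal M} mpoly_ring"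
  from vprime_of_primeideal_colon[OF M x(4)] obtain a where "a \<in> keys f" "vprime M a" by blast
  then show "x \<in> {enat (cdeg UNIV a) | a. a \<in> A \<and> vprime M a}"
    using x by (auto simp: homogeneous_of_degree_iff monomial_ideal_def)
next
  fix x a assume "x = enat (cdeg UNIV a)" "a \<in> A" "vprime M a"
  moreover from this have "primeideal {r :: ('v, 'k) mpoly. r * Poly_Mapping.single a 1 \<in> monomial_ideal M} mpoly_ring"
    using colon_monomial_eq_var_ideal[OF M] primeideal_var_ideal by metis
  ultimately show "x \<in> {enat d | d f. (f :: ('v, 'k) mpoly) \<in> monomial_ideal A \<and> homogeneous_of_degree d f \<and>
      primeideal {r. r * f \<in> monomial_ideal M} mpoly_ring}"
    by (intro CollectI exI[of _ "cdeg UNIV a"] exI[of _ "Poly_Mapping.single a 1"])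
      (simp add: homogeneous_of_degree_iff)
qed

section \<open>Squares of monomial ideals and contraction from a localization\<close>

lemma ideal_prod_monomial_ideal:
  fixes M N :: "('v \<Rightarrow>\<^sub>0 nat) set"
  assumes "up_closed M" "up_closed N"
  shows "ideal_prod mpoly_ring (monomial_ideal M) (monomial_ideal N)
    = (monomial_ideal {a + b | a b. a \<in> M \<and> b \<in> N} :: ('v, 'k::field) mpoly set)" (is "?L = ?R")
proof
  show "?L \<subseteq> ?R"
  proof
    fix f :: "('v, 'k) mpoly" assume "f \<in> ?L"
    then show "f \<in> ?R"
    proof induction
      case (prod f g)
      then show ?case using keys_mult[of f g] by (fastforce simp: monomial_ideal_def)
    next
      case (sum f g)
      then show ?case using keys_add[of f g] by (auto simp: monomial_ideal_def)
    qed
  qed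
  interpret cring "ring_of_type_algebra :: ('v, 'k) mpoly ring" by (rule cring_from_type_algebra)
  show "?R \<subseteq> ?L"
  proof (rule monomial_ideal_subset)
    show "ideal ?L mpoly_ring"
      using assms by (intro ideal_prod_is_ideal ideal_monomial_ideal)
    fix c assume "c \<in> {a + b | a b. a \<in> M \<and> b \<in> N}"
    then obtain a b where c: "c = a + b" "a \<in> M" "b \<in> N" by blast
    then have "Poly_Mapping.single a 1 \<otimes>\<^bsub>mpoly_ring\<^esub> Poly_Mapping.single b (1::'k) \<in> ?L"
      by (intro ideal_prod.prod) simp_all
    then show "Poly_Mapping.single c 1 \<in> ?L" by (simp add: c mult_single)
  qed
qed

lemma ideal_power_2:
  assumes "ideal I (ring_of_type_algebra :: 'a::comm_ring_1 ring)"
  shows "ideal_power ring_of_type_algebra I 2 = ideal_prod ring_of_type_algebra I I"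
proof -
  interpret cring "ring_of_type_algebra :: 'a ring" by (rule cring_from_type_algebra)
  have "ideal_prod ring_of_type_algebra (carrier ring_of_type_algebra) I = I"
    using assms ideal_prod_commute ideal_prod_one oneideal by metis
  then show ?thesis
    by (simp add: ideal_power_def nat_pow_def numeral_2_eq_2 ideals_set_def)
qed

text \<open>If f/1 = a/s with \<open>a\<close> in \<open>J\<close>, clearing denominators gives a
  multiplier \<open>u\<close> outside \<open>P\<close> with (u s) f = u a in \<open>J\<close>.
  Conversely f/1 = (s f)/s.\<close>

lemma loc_contraction_extension:
  fixes P J :: "'a::comm_ring_1 set"
  assumes "primeideal P ring_of_type_algebra" "ideal J ring_of_type_algebra"
  shows "loc_contraction ring_of_type_algebra P (loc_extension ring_of_type_algebra P J)
    = {f. \<exists>s. s \<notin> P \<and> s * f \<in> J}"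
proof -
  have P: "1 \<notin> P" "\<And>a b. a \<notin> P \<Longrightarrow> b \<notin> P \<Longrightarrow> a * b \<notin> P"
    using assms(1) unfolding primeideal_of_type_iff ideal_of_type_iff by (metis UNIV_eq_I mult.right_neutral, blast)
  have J: "\<And>a r. a \<in> J \<Longrightarrow> r * a \<in> J" using assms(2) by (auto simp: ideal_of_type_iff)
  have frac: "loc_frac ring_of_type_algebra P f 1 \<in> loc_extension ring_of_type_algebra P J
    \<longleftrightarrow> (\<exists>s. s \<notin> P \<and> s * f \<in> J)" (is "?l \<longleftrightarrow> ?r") for f
  proof
    assume ?l
    then obtain a s where as: "a \<in> J" "s \<notin> P"
      and eq: "loc_frac ring_of_type_algebra P f 1 = loc_frac ring_of_type_algebra P a s"
      by (auto simp: loc_extension_def)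
    have "(f, 1) \<in> loc_frac ring_of_type_algebra P f 1" using P by (auto simp: loc_frac_def)
    then obtain u where "u \<notin> P" "u * a = u * (f * s)" unfolding eq by (auto simp: loc_frac_def)
    then have "u * s \<notin> P" "(u * s) * f \<in> J"
      using as P J[of a u] by (auto simp: ac_simps)
    then show ?r by blast
  next
    assume ?r
    then obtain s where s: "s \<notin> P" "s * f \<in> J" by blast
    \<comment> \<open>Equality of the two fractions is equality of sets of pairs
      \<open>(b, t)\<close>: one direction multiplies both sides by \<open>s\<close>, the other
      absorbs \<open>s\<close> into the multiplier \<open>u\<close>.\<close>
    have "(\<exists>u. u \<notin> P \<and> u * (f * t) = u * b) \<longleftrightarrow> (\<exists>u. u \<notin> P \<and> u * (s * f * t) = u * (b * s))" for b t
    proof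
      assume "\<exists>u. u \<notin> P \<and> u * (f * t) = u * b"
      then obtain u where u: "u \<notin> P" "u * (f * t) = u * b" by blast
      from arg_cong[OF u(2), of "\<lambda>x. x * s"] u(1)
      show "\<exists>u. u \<notin> P \<and> u * (s * f * t) = u * (b * s)" by (intro exI[of _ u]) (simp add: ac_simps)
    next
      assume "\<exists>u. u \<notin> P \<and> u * (s * f * t) = u * (b * s)"
      then obtain u where "u \<notin> P" "u * (s * f * t) = u * (b * s)" by blast
      then show "\<exists>u. u \<notin> P \<and> u * (f * t) = u * b"
        using P(2) s(1) by (intro exI[of _ "u * s"]) (simp add: ac_simps)
    qed
    then have "loc_frac ring_of_type_algebra P f 1 = loc_frac ring_of_type_algebra P (s * f) s"
      by (simp add: loc_frac_def Bex_def)
    with s show ?l by (auto simp: loc_extension_def)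
  qed
  show ?thesis
    unfolding loc_contraction_def by (simp add: frac)
qed

section \<open>Exponents of the powers of the edge ideal\<close>

definition maximal_independent :: "'v ugraph \<Rightarrow> 'v set \<Rightarrow> bool" where
  "maximal_independent G W \<longleftrightarrow>
     independent_set G W \<and> (\<forall>A. independent_set G A \<longrightarrow> W \<subseteq> A \<longrightarrow> A = W)"

definition edge_exps :: "'v ugraph \<Rightarrow> ('v \<Rightarrow>\<^sub>0 nat) set" where
  "edge_exps G = {expvar i + expvar j + b | i j b. {i, j} \<in> edges G}"

definition edge_pair_exps :: "'v ugraph \<Rightarrow> ('v \<Rightarrow>\<^sub>0 nat) set" where
  "edge_pair_exps G = {a + b | a b. a \<in> edge_exps G \<and> b \<in> edge_exps G}"

text \<open>The complements of the maximal independent sets are the minimal vertex covers.\<close>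

definition cover_exps :: "'v::finite ugraph \<Rightarrow> ('v \<Rightarrow>\<^sub>0 nat) set" where
  "cover_exps G = {a. \<forall>W. maximal_independent G W \<longrightarrow> 2 \<le> cdeg (- W) a}"

definition indicator_exp :: "'v::finite set \<Rightarrow> 'v \<Rightarrow>\<^sub>0 nat" where
  "indicator_exp A = (\<Sum>i\<in>A. expvar i)"

lemma lookup_indicator_exp: "lookup (indicator_exp A) x = of_bool (x \<in> A)"
  by (simp add: indicator_exp_def lookup_sum lookup_single when_def)

lemma cdeg_indicator_exp: "cdeg C (indicator_exp A) = card (C \<inter> A)"
  by (simp add: cdeg_def lookup_indicator_exp)

lemma cdeg_split:
  assumes "cdeg C k \<noteq> 0"
  obtains i k' where "i \<in> C" "k = expvar i + k'" "cdeg C k = Suc (cdeg C k')"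
proof -
  obtain i where i: "i \<in> C" "lookup k i \<noteq> 0" using assms by (auto simp: cdeg_eq_0_iff)
  have k: "k = expvar i + (k - expvar i)" by (rule exponent_split[OF i(2)])
  then have "cdeg C k = cdeg C (expvar i) + cdeg C (k - expvar i)" by (metis cdeg_add)
  then have "cdeg C k = Suc (cdeg C (k - expvar i))" using i by (simp add: cdeg_expvar)
  with i k that show thesis by blast
qed

text \<open>The vertices exhaust the finite type that indexes the variables, so vertex covers are
  plain complements \<open>- W\<close>.\<close>

locale full_graph =
  fixes G :: "'v::finite ugraph"
  assumes simple: "simple_graph G" and full: "vertices G = UNIV"
begin

abbreviation adj :: "'v \<Rightarrow> 'v \<Rightarrow> bool" where "adj i j \<equiv> {i, j} \<in> edges G"

abbreviation indep :: "'v set \<Rightarrow> bool" where "indep \<equiv> independent_set G"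

abbreviation maxind :: "'v set \<Rightarrow> bool" where "maxind \<equiv> maximal_independent G"

lemma adj_sym: "adj i j \<Longrightarrow> adj j i"
  by (simp add: insert_commute)

lemma adj_irrefl [simp]: "{i} \<notin> edges G"
  using simple by (auto simp: simple_graph_def)

lemma adj_neq: "adj i j \<Longrightarrow> i \<noteq> j"
  by auto

lemma mem_nbrs_iff: "u \<in> nbrs G s \<longleftrightarrow> adj u s"
  by (simp add: nbrs_def full)

lemma indep_iff: "indep A \<longleftrightarrow> (\<forall>u\<in>A. \<forall>w\<in>A. \<not> adj u w)"
  by (simp add: independent_set_def full)

lemma indep_subset: "indep A \<Longrightarrow> B \<subseteq> A \<Longrightarrow> indep B"
  by (auto simp: indep_iff)

lemma maxind_extend:
  assumes "indep A"
  obtains W where "A \<subseteq> W" "maxind W"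
proof -
  have "\<exists>W\<in>{B. indep B}. A \<subseteq> W \<and> (\<forall>B\<in>{B. indep B}. W \<subseteq> B \<longrightarrow> W = B)"
    by (rule finite_has_maximal2) (use assms in auto)
  then obtain W where "W \<in> {B. indep B}" and W: "A \<subseteq> W \<and> (\<forall>B\<in>{B. indep B}. W \<subseteq> B \<longrightarrow> W = B)"
    by (rule bexE)
  then have "maxind W" by (simp add: maximal_independent_def) metis
  with W show thesis by (intro that[of W]) simp_all
qed

lemma maxind_nbr:
  assumes "maxind W" "i \<notin> W"
  obtains w where "w \<in> W" "adj i w"
proof -
  have "\<not> indep (insert i W)"
    using assms unfolding maximal_independent_def by blast
  moreover have "indep W" using assms by (simp add: maximal_independent_def)
  ultimately show thesis using that by (auto simp: indep_iff insert_commute)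
qed

lemma maxindI:
  assumes "indep W" "\<And>i. i \<notin> W \<Longrightarrow> \<exists>w\<in>W. adj i w"
  shows "maxind W"
  using assms unfolding maximal_independent_def indep_iff by blast

lemma maxind_indep: "maxind W \<Longrightarrow> indep W"
  by (simp add: maximal_independent_def)

lemma edge_exps_iff: "a \<in> edge_exps G \<longleftrightarrow> \<not> indep (keys a)"
proof
  assume "a \<in> edge_exps G"
  then obtain i j b where "adj i j" "a = expvar i + expvar j + b" by (auto simp: edge_exps_def)
  then have "adj i j" "i \<in> keys a" "j \<in> keys a" by (auto simp: in_keys_iff lookup_add)
  then show "\<not> indep (keys a)" by (auto simp: indep_iff)
next
  assume "\<not> indep (keys a)"
  then obtain i j where ij: "adj i j" "lookup a i \<noteq> 0" "lookup a j \<noteq> 0"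
    by (auto simp: indep_iff in_keys_iff)
  have "lookup (a - expvar i) j \<noteq> 0"
    using ij adj_neq[OF ij(1)] by (simp add: lookup_minus lookup_expvar)
  from exponent_split[OF this] exponent_split[OF ij(2)]
  have "a = expvar i + expvar j + (a - expvar i - expvar j)" by (metis add.assoc)
  with ij(1) show "a \<in> edge_exps G" unfolding edge_exps_def by blast
qed

lemma cdeg_eq_0_iff_subset: "cdeg (- W) a = 0 \<longleftrightarrow> keys a \<subseteq> W"
  by (auto simp: cdeg_eq_0_iff in_keys_iff)

text \<open>An independent support extends to a maximal independent set and has degree zero outside
  it, while a support with an edge fits into none. This is the decomposition of the edge ideal into
  minimal primes.\<close>

lemma edge_exps_iff_cdeg: "a \<in> edge_exps G \<longleftrightarrow> (\<forall>W. maxind W \<longrightarrow> cdeg (- W) a \<noteq> 0)"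
  unfolding edge_exps_iff cdeg_eq_0_iff_subset
  using maxind_extend[of "keys a"] indep_subset maxind_indep by metis

text \<open>The bound counts endpoints with multiplicity, so the two edges may share vertices or
  coincide if the exponents there are large enough.\<close>

lemma edge_pair_expsI:
  assumes "adj i j" "adj k l"
    and "\<And>x. of_bool (x = i) + of_bool (x = j) + of_bool (x = k) + of_bool (x = l) \<le> lookup a x"
  shows "a \<in> edge_pair_exps G"
proof -
  define r where "r = a - (expvar i + expvar j + expvar k + expvar l)"
  have "a = (expvar i + expvar j + 0) + (expvar k + expvar l + r)"
  proof (rule poly_mapping_eqI)
    fix x
    show "lookup a x = lookup ((expvar i + expvar j + 0) + (expvar k + expvar l + r)) x"
      using assms(3)[of x] unfolding r_def lookup_add lookup_minus lookup_expvar lookup_zero by linarith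
  qed
  with assms(1,2) show ?thesis unfolding edge_pair_exps_def edge_exps_def by blast
qed

lemma edge_pair_expsE:
  assumes "a \<in> edge_pair_exps G"
  obtains i j k l where "adj i j" "adj k l"
    "\<And>x. of_bool (x = i) + of_bool (x = j) + of_bool (x = k) + of_bool (x = l) \<le> lookup a x"
proof -
  from assms obtain i j b k l c where "adj i j" "adj k l"
    and a: "a = (expvar i + expvar j + b) + (expvar k + expvar l + c)"
    unfolding edge_pair_exps_def edge_exps_def by blast
  moreover have "of_bool (x = i) + of_bool (x = j) + of_bool (x = k) + of_bool (x = l) \<le> lookup a x" for x
    by (simp add: a lookup_add lookup_expvar)
  ultimately show thesis using that by blast
qed

lemma up_closed_edge_exps: "up_closed (edge_exps G)"
  unfolding up_closed_def edge_exps_def by clarify (metis add.assoc)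

lemma up_closed_edge_pair_exps: "up_closed (edge_pair_exps G)"
  unfolding up_closed_def
proof (intro ballI allI)
  fix a b assume "a \<in> edge_pair_exps G"
  then show "a + b \<in> edge_pair_exps G"
  proof (rule edge_pair_expsE)
    fix i j k l assume "adj i j" "adj k l"
      and le: "\<And>x. of_bool (x = i) + of_bool (x = j) + of_bool (x = k) + of_bool (x = l) \<le> lookup a x"
    show ?thesis
      by (rule edge_pair_expsI[OF \<open>adj i j\<close> \<open>adj k l\<close>]) (use le in \<open>simp only: lookup_add trans_le_add1\<close>)
  qed
qed

lemma up_closed_cover_exps: "up_closed (cover_exps G)"
  by (simp add: up_closed_def cover_exps_def trans_le_add1)

text \<open>An independent set contains no edge, so each of the two factors has positive degree
  outside \<open>W\<close>.\<close>

lemma edge_pair_exps_subset_cover_exps: "edge_pair_exps G \<subseteq> cover_exps G"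
proof
  fix c assume "c \<in> edge_pair_exps G"
  then obtain a b where c: "c = a + b" "a \<in> edge_exps G" "b \<in> edge_exps G"
    by (auto simp: edge_pair_exps_def)
  have "2 \<le> cdeg (- W) c" if "maxind W" for W
  proof -
    have "cdeg (- W) a \<noteq> 0" "cdeg (- W) b \<noteq> 0"
      using c that by (auto simp: edge_exps_iff_cdeg)
    then show ?thesis by (simp add: c)
  qed
  then show "c \<in> cover_exps G" by (simp add: cover_exps_def)
qed

text \<open>By maximality each of two vertices outside \<open>W\<close> has a neighbour in
  \<open>W\<close>; the doubled indicator supplies both neighbours even if they coincide. Hence the
  square of the product of the variables in \<open>W\<close>, a unit after localization at
  \<open>var_ideal (- W)\<close>, multiplies the square of that prime into I^2.\<close>

lemma add_twice_maxind_mem: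
  assumes W: "maxind W" and k: "2 \<le> cdeg (- W) k"
  shows "k + (indicator_exp W + indicator_exp W) \<in> edge_pair_exps G"
proof -
  obtain i k1 where i: "i \<in> - W" "k = expvar i + k1" "cdeg (- W) k = Suc (cdeg (- W) k1)"
    by (rule cdeg_split[of "- W" k]) (use k in auto)
  obtain j k2 where j: "j \<in> - W" "k1 = expvar j + k2"
    by (rule cdeg_split[of "- W" k1]) (use k i in auto)
  obtain v where v: "v \<in> W" "adj i v" using maxind_nbr[OF W, of i] i by blast
  obtain w where w: "w \<in> W" "adj j w" using maxind_nbr[OF W, of j] j by blast
  show ?thesis
    by (rule edge_pair_expsI[OF v(2) w(2)])
      (use v w in \<open>auto simp: i j lookup_add lookup_expvar lookup_indicator_exp\<close>)
qed

section \<open>The edge ideal, its square, its associated primes and its symbolic square\<close>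

lemma edge_ideal_eq: "edge_ideal G = (monomial_ideal (edge_exps G) :: ('v, 'k::field) mpoly set)"
proof -
  interpret cring "ring_of_type_algebra :: ('v, 'k) mpoly ring" by (rule cring_from_type_algebra)
  define gens :: "('v, 'k) mpoly set" where "gens = {Var i * Var j | i j. {i, j} \<in> edges G}"
  have single: "Var i * Var j = (Poly_Mapping.single (expvar i + expvar j) 1 :: ('v, 'k) mpoly)" for i j
    by (simp add: Var_eq mult_single)
  have id: "ideal (Idl\<^bsub>mpoly_ring\<^esub> gens) mpoly_ring" and self: "gens \<subseteq> Idl\<^bsub>mpoly_ring\<^esub> gens"
    by (rule genideal_ideal, simp) (rule genideal_self, simp)
  show ?thesis
    unfolding edge_ideal_def gens_def[symmetric]
  proof (rule antisym)
    show "Idl\<^bsub>mpoly_ring\<^esub> gens \<subseteq> monomial_ideal (edge_exps G)"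
    proof (rule genideal_minimal)
      show "ideal (monomial_ideal (edge_exps G) :: ('v, 'k) mpoly set) mpoly_ring"
        by (rule ideal_monomial_ideal[OF up_closed_edge_exps])
      show "gens \<subseteq> monomial_ideal (edge_exps G)"
        by (auto simp: gens_def single edge_exps_def) (metis add.right_neutral)
    qed
    show "monomial_ideal (edge_exps G) \<subseteq> Idl\<^bsub>mpoly_ring\<^esub> gens"
    proof (rule monomial_ideal_subset[OF id])
      fix a assume "a \<in> edge_exps G"
      then obtain i j b where a: "adj i j" "a = expvar i + expvar j + b" by (auto simp: edge_exps_def)
      then have "Poly_Mapping.single b 1 * (Var i * Var j) \<in> Idl\<^bsub>mpoly_ring\<^esub> gens"
        using self id unfolding ideal_of_type_iff gens_def by blast
      then show "Poly_Mapping.single a 1 \<in> Idl\<^bsub>mpoly_ring\<^esub> gens"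
        by (simp add: single mult_single a ac_simps)
    qed
  qed
qed

lemma ideal_edge_ideal: "ideal (edge_ideal G :: ('v, 'k::field) mpoly set) mpoly_ring"
  unfolding edge_ideal_eq by (rule ideal_monomial_ideal[OF up_closed_edge_exps])

lemma edge_ideal_power_2:
  "ideal_power mpoly_ring (edge_ideal G) 2 = (monomial_ideal (edge_pair_exps G) :: ('v, 'k::field) mpoly set)"
  unfolding ideal_power_2[OF ideal_edge_ideal] unfolding edge_ideal_eq edge_pair_exps_def
  by (rule ideal_prod_monomial_ideal[OF up_closed_edge_exps up_closed_edge_exps])

lemma edge_ideal_eq_INT_var_ideal:
  "edge_ideal G = (\<Inter>W\<in>Collect maxind. var_ideal (- W) :: ('v, 'k::field) mpoly set)"
  unfolding edge_ideal_eq by (auto simp: monomial_ideal_def mem_var_ideal_iff subset_iff edge_exps_iff_cdeg)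

text \<open>A colon ideal I : f is the intersection of the minimal primes that do not contain
  \<open>f\<close>; if it is prime, it equals one of them. Conversely the product of the variables
  in \<open>W\<close> has colon ideal \<open>var_ideal (- W)\<close>.\<close>

lemma Ass_edge_ideal:
  "Ass mpoly_ring (ideal_quot UNIV (edge_ideal G :: ('v, 'k::field) mpoly set)) = {var_ideal (- W) | W. maxind W}"
  unfolding Ass_ideal_quot[OF ideal_edge_ideal]
proof (intro equalityI subsetI; clarify)
  fix f :: "('v, 'k) mpoly"
  assume P: "primeideal {r. r * f \<in> edge_ideal G} mpoly_ring"
  define U where "U = {W. maxind W \<and> f \<notin> var_ideal (- W)}"
  have prime: "r * f \<in> var_ideal (- W) \<longleftrightarrow> r \<in> var_ideal (- W) \<or> f \<in> var_ideal (- W)"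
    for r :: "('v, 'k) mpoly" and W
    using primeideal_var_ideal[of "- W", where 'k = 'k]
    unfolding primeideal_of_type_iff ideal_of_type_iff by (metis mult.commute)
  have eq: "{r. r * f \<in> edge_ideal G} = (\<Inter>W\<in>U. var_ideal (- W))"
    by (auto simp: edge_ideal_eq_INT_var_ideal prime U_def)
  have "\<exists>W\<in>U. var_ideal (- W) \<subseteq> {r. r * f \<in> edge_ideal G}"
  proof (rule primeideal_INT_subset[OF P])
    show "ideal (var_ideal (- W) :: ('v, 'k) mpoly set) mpoly_ring" for W
      using primeideal_var_ideal unfolding primeideal_of_type_iff by blast
  qed (auto simp: eq)
  then obtain W where "W \<in> U" "var_ideal (- W) \<subseteq> {r. r * f \<in> edge_ideal G}" by blast
  with eq have "{r. r * f \<in> edge_ideal G} = var_ideal (- W)" by blast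
  with \<open>W \<in> U\<close> show "\<exists>W. {r. r * f \<in> edge_ideal G} = var_ideal (- W) \<and> maxind W"
    by (auto simp: U_def)
next
  fix W assume W: "maxind W"
  have mem: "k + indicator_exp W \<in> edge_exps G \<longleftrightarrow> cdeg (- W) k \<noteq> 0" for k
  proof -
    have "keys (k + indicator_exp W) = keys k \<union> W"
      by (auto simp: in_keys_iff lookup_add lookup_indicator_exp)
    \<comment> \<open>By maximality, no independent set properly contains \<open>W\<close>.\<close>
    moreover have "indep (keys k \<union> W) \<longleftrightarrow> keys k \<subseteq> W"
      using W unfolding maximal_independent_def by (metis Un_absorb1 Un_upper1 Un_upper2)
    ultimately show ?thesis unfolding edge_exps_iff cdeg_eq_0_iff_subset by simp
  qed
  have "var_ideal (- W) = {r :: ('v, 'k) mpoly. r * Poly_Mapping.single (indicator_exp W) 1 \<in> edge_ideal G}"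
    unfolding edge_ideal_eq by (simp add: mult_monomial_mem_iff mem mem_var_ideal_iff set_eq_iff)
  then show "primeideal (var_ideal (- W) :: ('v, 'k) mpoly set) mpoly_ring \<and>
    (\<exists>f\<in>UNIV. var_ideal (- W) = {r :: ('v, 'k) mpoly. r * f \<in> edge_ideal G})"
    using primeideal_var_ideal by blast
qed

text \<open>Each minimal prime contributes its own square: \<open>cdeg_cancel\<close> with
  \<open>d = 2\<close> bounds the degrees outside \<open>W\<close> from below, and
  \<open>add_twice_maxind_mem\<close> provides the multiplier for the converse.\<close>

lemma symbolic_square_edge_ideal:
  "symbolic_power (edge_ideal G) 2 = (monomial_ideal (cover_exps G) :: ('v, 'k::field) mpoly set)"
proof -
  have id: "ideal (monomial_ideal (edge_pair_exps G) :: ('v, 'k) mpoly set) mpoly_ring"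
    by (rule ideal_monomial_ideal[OF up_closed_edge_pair_exps])
  have local: "(\<exists>s. s \<notin> var_ideal (- W) \<and> s * f \<in> monomial_ideal (edge_pair_exps G)) \<longleftrightarrow>
      (\<forall>k\<in>keys f. 2 \<le> cdeg (- W) k)" (is "?l \<longleftrightarrow> ?r")
    if W: "maxind W" for W and f :: "('v, 'k) mpoly"
  proof
    assume ?l
    then obtain s where s: "s \<notin> var_ideal (- W)" "s * f \<in> monomial_ideal (edge_pair_exps G)" by blast
    then obtain b where b: "b \<in> keys s" "cdeg (- W) b = 0" by (auto simp: mem_var_ideal_iff)
    have "2 \<le> cdeg (- W) k" if "k \<in> keys (f * s)" for k
      using that s(2) edge_pair_exps_subset_cover_exps W
      by (auto simp: monomial_ideal_def cover_exps_def mult.commute)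
    from cdeg_cancel[OF this b] show ?r by blast
  next
    assume r: ?r
    define s :: "('v, 'k) mpoly" where "s = Poly_Mapping.single (indicator_exp W + indicator_exp W) 1"
    have "s \<notin> var_ideal (- W)" by (simp add: s_def mem_var_ideal_iff cdeg_indicator_exp)
    moreover have "s * f \<in> monomial_ideal (edge_pair_exps G)"
      using add_twice_maxind_mem[OF W] r by (simp add: s_def mult_monomial_mem_iff mult.commute[of _ f])
    ultimately show ?l by blast
  qed
  have "symbolic_power (edge_ideal G) 2 = (\<Inter>W\<in>Collect maxind.
      {f :: ('v, 'k) mpoly. \<exists>s. s \<notin> var_ideal (- W) \<and> s * f \<in> monomial_ideal (edge_pair_exps G)})"
    unfolding symbolic_power_def Ass_edge_ideal edge_ideal_power_2
    by (simp add: setcompr_eq_image loc_contraction_extension[OF primeideal_var_ideal id])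
  also have "\<dots> = monomial_ideal (cover_exps G)"
    by (simp add: local) (auto simp: monomial_ideal_def cover_exps_def)
  finally show ?thesis .
qed

end

section \<open>Exponents with prime colon ideals and v-witnesses\<close>

lemma cdeg_mono: "C \<subseteq> D \<Longrightarrow> cdeg C a \<le> cdeg D a"
  unfolding cdeg_def by (rule sum_mono2) auto

lemma cdeg_UNIV_eq_sum_keys: "cdeg UNIV a = (\<Sum>i\<in>keys a. lookup a i)"
  unfolding cdeg_def by (rule sum.mono_neutral_right) (auto simp: in_keys_iff)

lemma card_keys_le_cdeg: "card (keys a) \<le> cdeg UNIV a"
proof -
  have "(\<Sum>i\<in>keys a. 1) \<le> (\<Sum>i\<in>keys a. lookup a i)"
    by (rule sum_mono) (simp add: in_keys_iff Suc_le_eq)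
  then show ?thesis by (simp add: cdeg_UNIV_eq_sum_keys)
qed

lemma cdeg_eq_card_keys_imp:
  assumes "cdeg UNIV a \<le> card (keys a)"
  shows "a = indicator_exp (keys a)"
proof (rule poly_mapping_eqI, rule ccontr)
  fix i
  assume neq: "lookup a i \<noteq> lookup (indicator_exp (keys a)) i"
  then have i: "i \<in> keys a" "1 < lookup a i"
    by (auto simp: lookup_indicator_exp in_keys_iff of_bool_def split: if_splits)
  have "(\<Sum>i\<in>keys a. 1) < (\<Sum>i\<in>keys a. lookup a i)"
    by (rule sum_strict_mono_ex1) (use i in \<open>auto simp: in_keys_iff Suc_le_eq\<close>)
  with assms show False by (simp add: cdeg_UNIV_eq_sum_keys)
qed

context full_graph
begin

lemma mem_closed_nbrs_iff: "u \<in> closed_nbrs G S \<longleftrightarrow> u \<in> S \<or> (\<exists>s\<in>S. adj u s)"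
  by (auto simp: closed_nbrs_def mem_nbrs_iff)

text \<open>For \<open>S\<close> disjoint from \<open>U\<close>, the vertices of the smaller graph
  left uncovered by \<open>S\<close> are those outside \<open>U\<close> and
  \<open>closed_nbrs G S\<close>, with neighbourhoods taken in \<open>G\<close> itself.\<close>

lemma v_witness_delete_iff:
  "v_witness (delete_vertices G U) S \<longleftrightarrow> S \<inter> U = {} \<and> indep S \<and>
    (\<forall>u w. adj u w \<longrightarrow> u \<in> U \<union> closed_nbrs G S \<or> w \<in> U \<union> closed_nbrs G S)"
proof -
  have ind: "independent_set (delete_vertices G U) A \<longleftrightarrow> A \<inter> U = {} \<and> indep A" for A
    by (auto simp: independent_set_def delete_vertices_def full)
  have "u \<in> vertices (delete_vertices G U) - closed_nbrs (delete_vertices G U) S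
      \<longleftrightarrow> u \<notin> U \<union> closed_nbrs G S" if "S \<inter> U = {}" for u
    using that by (auto simp: delete_vertices_def closed_nbrs_def nbrs_def full)
  then have eq: "vertices (delete_vertices G U) - closed_nbrs (delete_vertices G U) S
      = - (U \<union> closed_nbrs G S)" if "S \<inter> U = {}"
    using that by blast
  show ?thesis
  proof (cases "S \<inter> U = {}")
    case True
    then show ?thesis unfolding v_witness_def ind eq[OF True] by (auto simp: indep_iff)
  next
    case False
    then show ?thesis by (simp add: v_witness_def ind)
  qed
qed

lemma v_witness_iff:
  "v_witness G S \<longleftrightarrow> indep S \<and> (\<forall>u w. adj u w \<longrightarrow> u \<in> closed_nbrs G S \<or> w \<in> closed_nbrs G S)"
  unfolding v_witness_def indep_iff full by blast

lemma edge_obtain: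
  assumes "edges G \<noteq> {}"
  obtains x y where "adj x y"
proof -
  obtain e where "e \<in> edges G" using assms by blast
  moreover from this have "card e = 2" using simple by (simp add: simple_graph_def)
  ultimately show thesis using that by (auto simp: card_2_iff)
qed

text \<open>Primality singles out one maximal independent set \<open>W\<close> that contains every
  independent set outside which \<open>a\<close> has degree at most one. Everything follows by
  testing this on small modifications of the support.\<close>

lemma vprime_cover_exps_imp_witness:
  assumes ne: "edges G \<noteq> {}" and a: "vprime (cover_exps G) a"
  shows "\<exists>S. v_witness G S \<and> card S + 1 + p_ind G S \<le> cdeg UNIV a"
proof -
  define D where "D = {i. a + expvar i \<in> cover_exps G}"
  have D_sub: "D \<subseteq> - W" if "maxind W" "cdeg (- W) a \<le> 1" for W
  proof
    fix i assume "i \<in> D"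
    then have "2 \<le> cdeg (- W) (a + expvar i)" using that by (simp add: D_def cover_exps_def)
    with that(2) show "i \<in> - W" by (cases "i \<in> W") auto
  qed
  \<comment> \<open>The square of the product of all variables outside the colon ideal still misses
    I^(2), so some \<open>W\<close> detects this. Because of the doubling, a vertex outside both
    \<open>D\<close> and \<open>W\<close> would already contribute two.\<close>
  define b where "b = indicator_exp (- D) + indicator_exp (- D)"
  have "a + b \<notin> cover_exps G"
  proof
    assume "a + b \<in> cover_exps G"
    then obtain i where "lookup b i \<noteq> 0" "a + expvar i \<in> cover_exps G"
      using a unfolding vprime_def by blast
    then show False by (simp add: b_def lookup_add lookup_indicator_exp D_def)
  qed
  then obtain W where W: "maxind W" "cdeg (- W) (a + b) < 2" by (auto simp: cover_exps_def not_le)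
  then have W1: "cdeg (- W) a \<le> 1" and "card (- W \<inter> - D) = 0"
    using W(2) unfolding b_def cdeg_add cdeg_indicator_exp by linarith+
  from this(2) have "- W \<inter> - D = {}" by (simp only: card_0_eq finite)
  then have D: "D = - W" using D_sub[OF W(1) W1] by blast
  have uniq: "A \<subseteq> W" if A: "indep A" "cdeg (- A) a \<le> 1" for A
  proof -
    obtain W' where W': "A \<subseteq> W'" "maxind W'" using maxind_extend[OF A(1)] .
    have "cdeg (- W') a \<le> cdeg (- A) a" using W'(1) by (intro cdeg_mono) auto
    with A have "cdeg (- W') a \<le> 1" by simp
    from D_sub[OF W'(2) this] D have "W' \<subseteq> W" by auto
    with W' show ?thesis by blast
  qed
  have indW: "indep W" using W(1) by (rule maxind_indep)
  obtain x y where "adj x y" using edge_obtain[OF ne] .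
  \<comment> \<open>An edge cannot lie in \<open>W\<close>, so some variable is in the colon ideal;
    it can raise the degree outside \<open>W\<close> to two only if that degree is already one. The
    vertex \<open>c\<close> is where it sits.\<close>
  then have "D \<noteq> {}" using indW by (auto simp: D indep_iff)
  then obtain i where i: "i \<in> D" by blast
  then have "2 \<le> cdeg (- W) (a + expvar i)" using W(1) by (simp add: D_def cover_exps_def)
  then have "cdeg (- W) a \<noteq> 0" by (cases "i \<in> W") auto
  then obtain c k where c: "c \<notin> W" "a = expvar c + k" "cdeg (- W) a = Suc (cdeg (- W) k)"
    by (metis ComplD cdeg_split)
  with W1 have "cdeg (- W) k = 0" by simp
  define S where "S = keys k"
  have S: "S \<subseteq> W" unfolding S_def using \<open>cdeg (- W) k = 0\<close> by (simp only: cdeg_eq_0_iff_subset)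
  have indS: "indep S" using indW S by (rule indep_subset)
  have kS: "cdeg (- S) k = 0" by (simp only: cdeg_eq_0_iff_subset S_def)
  have cS: "cdeg (- A) a \<le> 1" if "S \<subseteq> A" for A
  proof -
    have "cdeg (- A) a \<le> cdeg (- S) a" using that by (intro cdeg_mono) auto
    also have "\<dots> \<le> 1" by (simp add: c(2) kS)
    finally show ?thesis .
  qed
  \<comment> \<open>Otherwise \<open>insert c S\<close> would be an independent set violating
    \<open>uniq\<close>, since \<open>c\<close> is not in \<open>W\<close>.\<close>
  have "\<exists>s\<in>S. adj c s"
  proof (rule ccontr)
    assume "\<not> ?thesis"
    then have "indep (insert c S)" using indS by (auto simp: indep_iff insert_commute)
    from uniq[OF this cS] c(1) show False by blast
  qed
  then obtain s where s: "s \<in> S" "adj c s" by blast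
  \<comment> \<open>Adding an uncovered vertex to \<open>S\<close> keeps it independent, so
    \<open>uniq\<close> places all uncovered vertices in the independent set
    \<open>W\<close>.\<close>
  have new: "u \<in> W" if "u \<notin> closed_nbrs G S" for u
  proof -
    have "indep (insert u S)"
      using that indS by (auto simp: indep_iff mem_closed_nbrs_iff insert_commute)
    from uniq[OF this cS] show ?thesis by blast
  qed
  have "v_witness G S"
    using indS indW new unfolding v_witness_iff indep_iff by blast
  moreover have "card S + 1 + p_ind G S \<le> cdeg UNIV a"
  proof (rule ccontr)
    assume less: "\<not> ?thesis"
    have deg: "cdeg UNIV a = Suc (cdeg UNIV k)" by (simp add: c(2))
    \<comment> \<open>Since \<open>card S\<close> never exceeds the degree of \<open>k\<close>, the
      bound can fail only if \<open>p_ind G S\<close> is one and \<open>k\<close> is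
      squarefree.\<close>
    with less card_keys_le_cdeg[of k]
    have disj: "disjoint_family_on (nbrs G) S" and "cdeg UNIV k \<le> card (keys k)"
      by (auto simp: p_ind_def S_def split: if_splits)
    from cdeg_eq_card_keys_imp[OF this(2)] have k: "k = indicator_exp S" by (simp add: S_def)
    \<comment> \<open>Disjoint neighbourhoods make \<open>s\<close> the only neighbour of
      \<open>c\<close> in \<open>S\<close>, so \<open>s\<close> can be exchanged for
      \<open>c\<close>. Outside the new set \<open>a\<close> has degree at most one, although the
      set contains \<open>c\<close>.\<close>
    have "indep (insert c (S - {s}))"
    proof -
      have "t = s" if "t \<in> S" "adj c t" for t
        using that s disj unfolding disjoint_family_on_def by (metis disjoint_iff mem_nbrs_iff)
      then show ?thesis using indS by (auto simp: indep_iff insert_commute)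
    qed
    moreover have "cdeg (- insert c (S - {s})) a \<le> 1"
    proof -
      have "- insert c (S - {s}) \<inter> S \<subseteq> {s}" by auto
      then have "card (- insert c (S - {s}) \<inter> S) \<le> card {s}" by (intro card_mono) auto
      then show ?thesis by (simp add: c(2) k cdeg_indicator_exp)
    qed
    ultimately show False using uniq c(1) by blast
  qed
  ultimately show ?thesis by blast
qed

text \<open>Of two adjacent vertices one is covered by \<open>S\<close>; without neighbours in
  \<open>S\<close> it lies in \<open>S\<close>, which contradicts the choice of the other. A vertex
  outside the set has a neighbour in \<open>S\<close>, and \<open>S\<close> lies in the set.\<close>

lemma v_witness_maxind:
  assumes "v_witness G S"
  shows "maxind {x. \<forall>s\<in>S. \<not> adj x s}"
proof (rule maxindI)
  have S: "indep S" "\<And>u w. adj u w \<Longrightarrow> u \<in> closed_nbrs G S \<or> w \<in> closed_nbrs G S"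
    using assms by (auto simp: v_witness_iff)
  show "indep {x. \<forall>s\<in>S. \<not> adj x s}"
    unfolding indep_iff
  proof (intro ballI notI)
    fix u w assume uw: "u \<in> {x. \<forall>s\<in>S. \<not> adj x s}" "w \<in> {x. \<forall>s\<in>S. \<not> adj x s}" "adj u w"
    with S(2)[OF uw(3)] have "u \<in> S \<or> w \<in> S" by (auto simp: mem_closed_nbrs_iff)
    with uw show False using adj_sym by blast
  qed
  fix i assume "i \<notin> {x. \<forall>s\<in>S. \<not> adj x s}"
  with S(1) show "\<exists>w\<in>{x. \<forall>s\<in>S. \<not> adj x s}. adj i w" by (auto simp: indep_iff)
qed

text \<open>Outside \<open>W\<close> the exponent \<open>a\<close> has degree one, so a multiple in
  I^2 brings in a vertex \<open>i\<close> outside \<open>W\<close>, which has a neighbour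
  \<open>s'\<close> in \<open>S\<close>. The last hypothesis leaves a neighbour \<open>t\<close> of
  \<open>c\<close> available after \<open>s'\<close> is used, so the edges \<open>i s'\<close> and
  \<open>c t\<close> show that \<open>i\<close> alone suffices.\<close>

lemma vprime_edge_pair_exps_witness:
  assumes wit: "v_witness G S" and s: "s \<in> S" "adj c s"
    and a: "keys a = insert c S" "lookup a c = 1"
    and other: "\<And>s'. s' \<in> S \<Longrightarrow> \<exists>t\<in>S. adj c t \<and> (t = s' \<longrightarrow> 2 \<le> lookup a t)"
  shows "vprime (edge_pair_exps G) a \<and> a \<notin> cover_exps G"
proof -
  define W where "W = {x. \<forall>s\<in>S. \<not> adj x s}"
  have W: "maxind W" unfolding W_def by (rule v_witness_maxind[OF wit])
  have indS: "indep S" using wit by (simp add: v_witness_iff)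
  then have c: "c \<notin> S" using s by (auto simp: indep_iff)
  have "cdeg (- W) a = (\<Sum>i\<in>{c}. lookup a i)"
    unfolding cdeg_def
  proof (rule sum.mono_neutral_right)
    show "{c} \<subseteq> - W" using s by (auto simp: W_def)
    have "S \<subseteq> W" using indS by (auto simp: W_def indep_iff)
    then have "i \<notin> keys a" if "i \<in> - W - {c}" for i using that a(1) by auto
    then show "\<forall>i\<in>- W - {c}. lookup a i = 0" by (simp add: in_keys_iff)
  qed simp
  then have deg: "cdeg (- W) a = 1" using a by simp
  then have nc: "a \<notin> cover_exps G" using W by (force simp: cover_exps_def)
  have "\<exists>i. lookup b i \<noteq> 0 \<and> a + expvar i \<in> edge_pair_exps G" if "a + b \<in> edge_pair_exps G" for b
  proof -
    have "a + b \<in> cover_exps G" using that edge_pair_exps_subset_cover_exps by blast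
    then have "2 \<le> cdeg (- W) (a + b)" using W by (auto simp: cover_exps_def)
    with deg have "cdeg (- W) b \<noteq> 0" by simp
    then obtain i where i: "i \<notin> W" "lookup b i \<noteq> 0" by (auto simp: cdeg_eq_0_iff)
    then obtain s' where s': "s' \<in> S" "adj i s'" by (auto simp: W_def)
    obtain t where t: "t \<in> S" "adj c t" "t = s' \<longrightarrow> 2 \<le> lookup a t" using other[OF s'(1)] by blast
    have pos: "1 \<le> lookup a x" if "x \<in> insert c S" for x
      using that unfolding a(1)[symmetric] by (simp add: in_keys_iff Suc_le_eq)
    have "a + expvar i \<in> edge_pair_exps G"
    proof (rule edge_pair_expsI[OF s'(2) t(2)])
      fix x
      have "of_bool (x = s') + of_bool (x = c) + of_bool (x = t) \<le> lookup a x"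
        using s' t c pos[of x] by (cases "x = c"; cases "x = s'"; cases "x = t") auto
      then show "of_bool (x = i) + of_bool (x = s') + of_bool (x = c) + of_bool (x = t) \<le> lookup (a + expvar i) x"
        unfolding lookup_add lookup_expvar by linarith
    qed
    with i show ?thesis by blast
  qed
  with nc show ?thesis
    using edge_pair_exps_subset_cover_exps unfolding vprime_def by blast
qed

lemma witness_imp_vprime:
  assumes wit: "v_witness G S" and ne: "edges G \<noteq> {}"
  shows "\<exists>a. cdeg UNIV a = card S + 1 + p_ind G S \<and> vprime (edge_pair_exps G) a \<and> a \<notin> cover_exps G"
proof (cases "disjoint_family_on (nbrs G) S")
  case True
  obtain x y where xy: "adj x y" using edge_obtain[OF ne] .
  \<comment> \<open>The edge meets \<open>closed_nbrs G S\<close>, so some vertex of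
    \<open>S\<close> has a neighbour, whichever way the edge is covered.\<close>
  then have "x \<in> closed_nbrs G S \<or> y \<in> closed_nbrs G S" using wit by (auto simp: v_witness_iff)
  then obtain s c where s: "s \<in> S" "adj c s" using xy adj_sym by (auto simp: mem_closed_nbrs_iff)
  have c: "c \<notin> S" using wit s by (auto simp: v_witness_iff indep_iff)
  define a where "a = indicator_exp S + expvar s + expvar c"
  have "vprime (edge_pair_exps G) a \<and> a \<notin> cover_exps G"
  proof (rule vprime_edge_pair_exps_witness[OF wit s])
    show "keys a = insert c S" "lookup a c = 1"
      using s c by (auto simp: a_def in_keys_iff lookup_add lookup_indicator_exp)
    show "\<exists>t\<in>S. adj c t \<and> (t = s' \<longrightarrow> 2 \<le> lookup a t)" for s'
      using s c by (intro bexI[of _ s]) (auto simp: a_def lookup_add lookup_indicator_exp)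
  qed
  then show ?thesis
    using True by (intro exI[of _ a]) (simp add: a_def cdeg_indicator_exp p_ind_def)
next
  case False
  then obtain s t c where st: "s \<in> S" "t \<in> S" "s \<noteq> t" "adj c s" "adj c t"
    by (auto simp: disjoint_family_on_def disjoint_iff mem_nbrs_iff)
  have c: "c \<notin> S" using wit st by (auto simp: v_witness_iff indep_iff)
  define a where "a = indicator_exp S + expvar c"
  have "vprime (edge_pair_exps G) a \<and> a \<notin> cover_exps G"
  proof (rule vprime_edge_pair_exps_witness[OF wit st(1,4)])
    show "keys a = insert c S" "lookup a c = 1"
      using c by (auto simp: a_def in_keys_iff lookup_add lookup_indicator_exp)
    \<comment> \<open>If \<open>s\<close> is used up by \<open>s'\<close>, the second neighbour
      \<open>t\<close> of \<open>c\<close> remains, so no exponent has to be doubled.\<close>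
    show "\<exists>t\<in>S. adj c t \<and> (t = s' \<longrightarrow> 2 \<le> lookup a t)" for s'
      using st by (cases "s' = s") auto
  qed
  then show ?thesis
    using False by (intro exI[of _ a]) (simp add: a_def cdeg_indicator_exp p_ind_def)
qed

text \<open>Choose \<open>W\<close> with degree of \<open>a\<close> at most one outside it.
  Multiplying by the squared product over \<open>W\<close> moves a multiple from I^(2) into I^2, and
  the variable found there is not in \<open>W\<close>, as such a variable would not raise the degree
  outside \<open>W\<close>; so it divides the original multiplier.\<close>

lemma vprime_edge_pair_exps_imp_cover_exps:
  assumes a: "vprime (edge_pair_exps G) a" "a \<notin> cover_exps G"
  shows "vprime (cover_exps G) a"
  unfolding vprime_def
proof (intro conjI allI impI a(2))
  fix b assume b: "a + b \<in> cover_exps G"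
  from a(2) obtain W where W: "maxind W" "cdeg (- W) a \<le> 1" by (force simp: cover_exps_def not_le)
  have "2 \<le> cdeg (- W) (a + b)" using b W(1) by (auto simp: cover_exps_def)
  from add_twice_maxind_mem[OF W(1) this]
  have "a + (b + (indicator_exp W + indicator_exp W)) \<in> edge_pair_exps G" by (simp add: add.assoc)
  then obtain i where i: "lookup (b + (indicator_exp W + indicator_exp W)) i \<noteq> 0"
    "a + expvar i \<in> edge_pair_exps G"
    using a(1) unfolding vprime_def by blast
  then have mem: "a + expvar i \<in> cover_exps G" using edge_pair_exps_subset_cover_exps by blast
  then have "2 \<le> cdeg (- W) (a + expvar i)" using W(1) by (simp add: cover_exps_def)
  with W(2) have "i \<notin> W" by (cases "i \<in> W") auto
  with i(1) mem show "\<exists>i. lookup b i \<noteq> 0 \<and> a + expvar i \<in> cover_exps G"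
    by (auto simp: lookup_add lookup_indicator_exp)
qed

end

section \<open>Triangles\<close>

context full_graph
begin

lemma triangle_obtain:
  assumes "triangle G T"
  obtains x y z where "T = {x, y, z}" "adj x y" "adj y z" "adj x z"
proof -
  from assms obtain x y z where "T = {x, y, z}" "x \<noteq> y" "y \<noteq> z" "x \<noteq> z"
    by (auto simp: triangle_def card_3_iff)
  with assms that show thesis by (auto simp: triangle_def)
qed

lemma triangleI: "adj x y \<Longrightarrow> adj y z \<Longrightarrow> adj x z \<Longrightarrow> triangle G {x, y, z}"
  using adj_neq[of x y] adj_neq[of y z] adj_neq[of x z]
  by (auto simp: triangle_def full insert_commute)

text \<open>Without a triangle the edges in the support of \<open>a\<close> form a star whose centre has exponent
  one, and the remaining vertices extend to a maximal independent set.\<close>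

lemma cover_exps_imp_triangle:
  assumes a: "a \<in> cover_exps G" "a \<notin> edge_pair_exps G"
  obtains T where "triangle G T" "T \<subseteq> keys a"
proof -
  define U where "U = keys a"
  have pos: "1 \<le> lookup a u" if "u \<in> U" for u
    using that by (simp add: U_def in_keys_iff Suc_le_eq)
  have large: "2 \<le> cdeg (- A) a" if "indep A" for A
  proof -
    obtain W where W: "A \<subseteq> W" "maxind W" using maxind_extend[OF \<open>indep A\<close>] .
    have "2 \<le> cdeg (- W) a" using a(1) W(2) by (simp add: cover_exps_def)
    also have "\<dots> \<le> cdeg (- A) a" using W(1) by (intro cdeg_mono) auto
    finally show ?thesis .
  qed
  have "\<not> indep U"
  proof
    assume "indep U"
    from large[OF this] show False by (simp add: U_def cdeg_eq_0_iff_subset[THEN iffD2])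
  qed
  then obtain x y where xy: "x \<in> U" "y \<in> U" "adj x y" by (auto simp: indep_iff)
  \<comment> \<open>Two disjoint edges in the support would put \<open>a\<close> into
    \<open>edge_pair_exps G\<close>, so any two edges there meet.\<close>
  have meet: "{i, j} \<inter> {k, l} \<noteq> {}" if "adj i j" "adj k l" "{i, j, k, l} \<subseteq> U" for i j k l
  proof
    assume disj: "{i, j} \<inter> {k, l} = {}"
    have "a \<in> edge_pair_exps G"
    proof (rule edge_pair_expsI[OF that(1,2)])
      fix u
      show "of_bool (u = i) + of_bool (u = j) + of_bool (u = k) + of_bool (u = l) \<le> lookup a u"
        using that(3) disj adj_neq[OF that(1)] adj_neq[OF that(2)] pos[of u]
        by (cases "u \<in> {i, j, k, l}") auto
    qed
    with a(2) show False by simp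
  qed
  have star: False if "adj i j" "adj i k" "j \<noteq> k" "{i, j, k} \<subseteq> U" "2 \<le> lookup a i" for i j k
  proof -
    have "a \<in> edge_pair_exps G"
    proof (rule edge_pair_expsI[OF that(1,2)])
      fix u
      show "of_bool (u = i) + of_bool (u = j) + of_bool (u = i) + of_bool (u = k) \<le> lookup a u"
        using that(3-) adj_neq[OF that(1)] adj_neq[OF that(2)] pos[of u]
        by (cases "u \<in> {i, j, k}") auto
    qed
    with a(2) show False by simp
  qed
  \<comment> \<open>If \<open>j\<close> has no further neighbour in \<open>U\<close>, every edge of
    \<open>U\<close> contains \<open>i\<close>. Then \<open>U - {i}\<close> is independent, and the
    degree outside it is the exponent of \<open>i\<close>.\<close>
  have leaf: "2 \<le> lookup a i \<or> (\<exists>k\<in>U. adj j k \<and> k \<noteq> i)" if "i \<in> U" "j \<in> U" "adj i j" for i j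
  proof (rule ccontr)
    assume neg: "\<not> ?thesis"
    have "indep (U - {i})"
      unfolding indep_iff
    proof (intro ballI notI)
      fix u w assume uw: "u \<in> U - {i}" "w \<in> U - {i}" "adj u w"
      then have "{i, j} \<inter> {u, w} \<noteq> {}" using that by (intro meet) auto
      with uw have "j = u \<or> j = w" by auto
      with uw neg show False using adj_sym[OF uw(3)] by auto
    qed
    from large[OF this] have "2 \<le> cdeg (- (U - {i})) a" .
    also have "\<dots> = (\<Sum>u\<in>{i}. lookup a u)"
      unfolding cdeg_def by (rule sum.mono_neutral_right) (auto simp: U_def in_keys_iff)
    finally show False using neg by simp
  qed
  have "\<exists>z\<in>U. adj x z \<and> adj y z"
  proof -
    \<comment> \<open>\<open>leaf\<close> is used at both ends of the edge. Two further neighbours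
      coincide by \<open>meet\<close> and close a triangle; in the other cases a repeated vertex
      puts \<open>a\<close> into \<open>edge_pair_exps G\<close>.\<close>
    consider z w where "z \<in> U" "adj y z" "z \<noteq> x" "w \<in> U" "adj x w" "w \<noteq> y"
      | z where "z \<in> U" "adj y z" "z \<noteq> x" "2 \<le> lookup a y"
      | w where "w \<in> U" "adj x w" "w \<noteq> y" "2 \<le> lookup a x"
      | "2 \<le> lookup a x" "2 \<le> lookup a y"
      using leaf[OF xy] leaf[OF xy(2,1) adj_sym[OF xy(3)]] by blast
    then show ?thesis
    proof cases
      case 1
      have "{y, z} \<inter> {x, w} \<noteq> {}" using 1 xy by (intro meet) auto
      then have "z = w" using 1 xy by auto
      with 1 show ?thesis by blast
    next
      case 2
      with star[OF adj_sym[OF xy(3)], of z] xy show ?thesis by auto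
    next
      case 3
      with star[OF xy(3), of w] xy show ?thesis by auto
    next
      case 4
      have "a \<in> edge_pair_exps G"
        by (rule edge_pair_expsI[OF xy(3) xy(3)]) (use 4 adj_neq[OF xy(3)] in auto)
      with a(2) show ?thesis by simp
    qed
  qed
  then obtain z where "z \<in> U" "adj x z" "adj y z" by blast
  with xy that[of "{x, y, z}"] triangleI show thesis by (auto simp: U_def)
qed

text \<open>The support contains no two disjoint edges, which separates its part \<open>S\<close>
  outside the triangle from \<open>T\<close> and makes it independent. An edge avoiding both closed
  neighbourhoods would force one of its endpoints into the colon ideal, but neither endpoint has a
  neighbour in the support.\<close>

lemma vprime_triangle_witness:
  assumes a: "vprime (edge_pair_exps G) a" "a \<in> cover_exps G"
  shows "\<exists>T S. triangle G T \<and> v_witness (delete_vertices G (closed_nbrs G T)) S \<and>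
    card S + 3 \<le> cdeg UNIV a"
proof -
  have na: "a \<notin> edge_pair_exps G" using a(1) by (simp add: vprime_def)
  obtain T where T: "triangle G T" "T \<subseteq> keys a" using cover_exps_imp_triangle[OF a(2) na] .
  obtain x y z where xyz: "T = {x, y, z}" "adj x y" "adj y z" "adj x z"
    using triangle_obtain[OF T(1)] .
  have other: "\<exists>u v. adj u v \<and> T = {t, u, v} \<and> t \<noteq> u \<and> t \<noteq> v" if "t \<in> T" for t
    using that xyz adj_neq[OF xyz(2)] adj_neq[OF xyz(3)] adj_neq[OF xyz(4)]
    by (auto simp: insert_commute)
  define S where "S = keys a - T"
  have pos: "1 \<le> lookup a u" if "u \<in> T \<union> S" for u
    using that T(2) by (auto simp: S_def in_keys_iff Suc_le_eq)
  have disj: False if "adj i j" "adj k l" "{i, j, k, l} \<subseteq> T \<union> S" "{i, j} \<inter> {k, l} = {}" for i j k l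
  proof -
    have "a \<in> edge_pair_exps G"
    proof (rule edge_pair_expsI[OF that(1,2)])
      fix u
      show "of_bool (u = i) + of_bool (u = j) + of_bool (u = k) + of_bool (u = l) \<le> lookup a u"
        using that(3-) adj_neq[OF that(1)] adj_neq[OF that(2)] pos[of u]
        by (cases "u \<in> {i, j, k, l}") auto
    qed
    with na show False by simp
  qed
  have ST: "s \<notin> closed_nbrs G T" if "s \<in> S" for s
  proof
    assume "s \<in> closed_nbrs G T"
    then obtain t where t: "t \<in> T" "adj s t" using \<open>s \<in> S\<close> by (auto simp: mem_closed_nbrs_iff S_def)
    obtain u v where "adj u v" "T = {t, u, v}" "t \<noteq> u" "t \<noteq> v" using other[OF t(1)] by blast
    \<comment> \<open>The edge from \<open>s\<close> to \<open>t\<close> is disjoint from the side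
      of the triangle opposite \<open>t\<close>.\<close>
    with disj[OF t(2), of u v] that show False by (auto simp: S_def)
  qed
  have indS: "indep S"
    unfolding indep_iff
  proof (intro ballI notI)
    fix u w assume "u \<in> S" "w \<in> S" "adj u w"
    with disj[of u w x y] xyz show False by (auto simp: S_def)
  qed
  have outer: "a + expvar i \<notin> edge_pair_exps G" if "i \<notin> closed_nbrs G T \<union> closed_nbrs G S" for i
  proof
    assume "a + expvar i \<in> edge_pair_exps G"
    then obtain p q r s where e: "adj p q" "adj r s"
      and le: "\<And>x. of_bool (x = p) + of_bool (x = q) + of_bool (x = r) + of_bool (x = s) \<le> lookup (a + expvar i) x"
      by (rule edge_pair_expsE) blast
    have non: "\<not> adj i j" if "j \<in> keys a" for j
      using that \<open>i \<notin> _\<close> by (auto simp: mem_closed_nbrs_iff S_def)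
    have supp: "j \<in> keys a" if "j \<in> {p, q, r, s}" "j \<noteq> i" for j
    proof (rule ccontr)
      assume "j \<notin> keys a"
      with le[of j] that show False by (auto simp: lookup_add in_keys_iff split: if_splits)
    qed
    \<comment> \<open>If an endpoint were \<open>i\<close>, the other endpoint of its edge would be
      in the support and adjacent to \<open>i\<close>. So \<open>i\<close> occurs in neither edge,
      and both edges are available in \<open>a\<close> already.\<close>
    have "p \<noteq> i" using non[of q] supp[of q] e(1) adj_neq[OF e(1)] by auto
    have "q \<noteq> i" using non[of p] supp[of p] adj_sym[OF e(1)] adj_neq[OF e(1)] by auto
    have "r \<noteq> i" using non[of s] supp[of s] e(2) adj_neq[OF e(2)] by auto
    have "s \<noteq> i" using non[of r] supp[of r] adj_sym[OF e(2)] adj_neq[OF e(2)] by auto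
    have "a \<in> edge_pair_exps G"
    proof (rule edge_pair_expsI[OF e])
      fix x
      show "of_bool (x = p) + of_bool (x = q) + of_bool (x = r) + of_bool (x = s) \<le> lookup a x"
        using le[of x] \<open>p \<noteq> i\<close> \<open>q \<noteq> i\<close> \<open>r \<noteq> i\<close> \<open>s \<noteq> i\<close> by (cases "x = i") (auto simp: lookup_add)
    qed
    with na show False by simp
  qed
  have "v_witness (delete_vertices G (closed_nbrs G T)) S"
    unfolding v_witness_delete_iff
  proof (intro conjI allI impI indS)
    show "S \<inter> closed_nbrs G T = {}" using ST by blast
    fix u w assume uw: "adj u w"
    show "u \<in> closed_nbrs G T \<union> closed_nbrs G S \<or> w \<in> closed_nbrs G T \<union> closed_nbrs G S"
    proof (rule ccontr)
      assume neg: "\<not> ?thesis"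
      \<comment> \<open>The uncovered edge and a side of the triangle form the required pair, so
        \<open>vprime\<close> yields \<open>u\<close> or \<open>w\<close>, contrary to
        \<open>outer\<close>.\<close>
      have "a + (expvar u + expvar w) \<in> edge_pair_exps G"
      proof (rule edge_pair_expsI[OF uw xyz(2)])
        have "x \<notin> {u, w}" "y \<notin> {u, w}" using neg xyz by (auto simp: mem_closed_nbrs_iff)
        then show "of_bool (v = u) + of_bool (v = w) + of_bool (v = x) + of_bool (v = y)
            \<le> lookup (a + (expvar u + expvar w)) v" for v
          using pos[of v] xyz adj_neq[OF xyz(2)]
          by (cases "v \<in> {x, y}") (auto simp: lookup_add)
      qed
      then obtain i where "lookup (expvar u + expvar w) i \<noteq> 0" "a + expvar i \<in> edge_pair_exps G"
        using a(1) unfolding vprime_def by blast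
      then have "i = u \<or> i = w" by (auto simp: lookup_add split: if_splits)
      with neg outer[of i] \<open>a + expvar i \<in> _\<close> show False by auto
    qed
  qed
  moreover have "card S + 3 = card (keys a)"
  proof -
    have "card T = 3" using T(1) by (simp add: triangle_def)
    moreover have "card (keys a - T) = card (keys a) - card T"
      using T(2) by (intro card_Diff_subset) auto
    moreover have "card T \<le> card (keys a)" using T(2) by (intro card_mono) auto
    ultimately show ?thesis by (simp add: S_def)
  qed
  ultimately show ?thesis using T(1) card_keys_le_cdeg[of a] by metis
qed

text \<open>Multiplicity at most one makes the four endpoints distinct, but \<open>T\<close> has
  three vertices.\<close>

lemma triangle_edge_pair_false:
  assumes "triangle G T" "adj p q" "adj r s" "{p, q, r, s} \<subseteq> T"
    and "\<And>x. x \<in> T \<Longrightarrow> of_bool (x = p) + of_bool (x = q) + of_bool (x = r) + of_bool (x = s) \<le> (1::nat)"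
  shows False
proof -
  have "p \<noteq> q" "r \<noteq> s" using assms(2,3) adj_neq by blast+
  moreover have "p \<noteq> r" "p \<noteq> s" "q \<noteq> r" "q \<noteq> s"
    using assms(5)[of p] assms(5)[of q] assms(4) by (auto split: if_splits)
  ultimately have "card {p, q, r, s} = 4" by simp
  moreover have "card {p, q, r, s} \<le> card T" using assms(4) by (intro card_mono) auto
  ultimately show False using assms(1) by (simp add: triangle_def)
qed

text \<open>The monomial is the product over \<open>T\<close> and \<open>S\<close>. Its colon ideal
  contains every variable in the closed neighbourhood of \<open>T\<close> and every neighbour of
  \<open>S\<close>; if a multiplier avoids these, edges can use only vertices of \<open>T\<close>,
  which has no room for two.\<close>

lemma triangle_witness_imp_vprime:
  assumes T: "triangle G T" and wit: "v_witness (delete_vertices G (closed_nbrs G T)) S"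
  shows "\<exists>a. a \<in> cover_exps G \<and> vprime (edge_pair_exps G) a \<and> cdeg UNIV a = card S + 3"
proof -
  obtain x y z where xyz: "T = {x, y, z}" "adj x y" "adj y z" "adj x z"
    using triangle_obtain[OF T] .
  have other: "\<exists>u v. adj u v \<and> adj t u \<and> adj t v \<and> T = {t, u, v}" if "t \<in> T" for t
  proof -
    from that xyz(1) consider "t = x" | "t = y" | "t = z" by auto
    then show ?thesis
    proof cases
      case 1
      with xyz show ?thesis by (intro exI[of _ y] exI[of _ z]) auto
    next
      case 2
      with xyz adj_sym[OF xyz(2)] show ?thesis by (intro exI[of _ x] exI[of _ z]) auto
    next
      case 3
      with xyz adj_sym[OF xyz(3)] adj_sym[OF xyz(4)] show ?thesis
        by (intro exI[of _ x] exI[of _ y]) auto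
    qed
  qed
  have S: "S \<inter> closed_nbrs G T = {}" "indep S"
    and cov: "\<And>u w. adj u w \<Longrightarrow> u \<in> closed_nbrs G T \<union> closed_nbrs G S \<or> w \<in> closed_nbrs G T \<union> closed_nbrs G S"
    using wit unfolding v_witness_delete_iff by blast+
  have ST: "S \<inter> T = {}" using S(1) by (auto simp: mem_closed_nbrs_iff)
  define a where "a = indicator_exp (T \<union> S)"
  have la: "lookup a u = of_bool (u \<in> T \<union> S)" for u by (simp add: a_def lookup_indicator_exp)
  have inside: "{u, v} \<subseteq> T \<or> u \<notin> closed_nbrs G T \<and> v \<notin> closed_nbrs G T"
    if "adj u v" "u \<in> T \<or> u \<notin> closed_nbrs G T" "v \<in> T \<or> v \<notin> closed_nbrs G T" for u v
    using that adj_sym[OF that(1)] by (auto simp: mem_closed_nbrs_iff)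
  have prime: "\<exists>i. lookup b i \<noteq> 0 \<and> a + expvar i \<in> edge_pair_exps G"
    if ab: "a + b \<in> edge_pair_exps G" for b
  proof (rule ccontr)
    assume neg: "\<not> ?thesis"
    \<comment> \<open>A vertex of \<open>T\<close> supplies the second copy for two sides through
      it; any other neighbour of some \<open>t\<close> in \<open>T\<close> gives an edge to
      \<open>t\<close>, disjoint from the opposite side.\<close>
    have bT: "i \<notin> closed_nbrs G T" if "lookup b i \<noteq> 0" for i
    proof
      assume i: "i \<in> closed_nbrs G T"
      have "a + expvar i \<in> edge_pair_exps G"
      proof (cases "i \<in> T")
        case True
        then obtain u v where uv: "adj u v" "adj i u" "adj i v" "T = {i, u, v}" using other by blast
        show ?thesis
          by (rule edge_pair_expsI[OF uv(2,3)])
            (use uv adj_neq[OF uv(1)] adj_neq[OF uv(2)] adj_neq[OF uv(3)] in \<open>auto simp: lookup_add la\<close>)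
      next
        case False
        then obtain t where t: "t \<in> T" "adj i t" using i by (auto simp: mem_closed_nbrs_iff)
        then obtain u v where uv: "adj u v" "adj t u" "adj t v" "T = {t, u, v}" using other by blast
        show ?thesis
          by (rule edge_pair_expsI[OF t(2) uv(1)])
            (use uv False adj_neq[OF uv(1)] adj_neq[OF uv(2)] adj_neq[OF uv(3)] in \<open>auto simp: lookup_add la\<close>)
      qed
      with neg that show False by blast
    qed
    have bS: "\<not> adj i s" if "lookup b i \<noteq> 0" "s \<in> S" for i s
    proof
      assume si: "adj i s"
      have "i \<notin> T" using bT[OF that(1)] by (auto simp: mem_closed_nbrs_iff)
      have "a + expvar i \<in> edge_pair_exps G"
        by (rule edge_pair_expsI[OF si xyz(2)])
          (use xyz that ST \<open>i \<notin> T\<close> adj_neq[OF si] adj_neq[OF xyz(2)] in \<open>auto simp: lookup_add la\<close>)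
      with neg that show False by blast
    qed
    from ab obtain p q r s where e: "adj p q" "adj r s"
      and le: "\<And>x. of_bool (x = p) + of_bool (x = q) + of_bool (x = r) + of_bool (x = s) \<le> lookup (a + b) x"
      by (rule edge_pair_expsE) blast
    have supp: "j \<in> T \<or> j \<in> S \<or> lookup b j \<noteq> 0" if "j \<in> {p, q, r, s}" for j
    proof (rule ccontr)
      assume "\<not> ?thesis"
      with le[of j] that show False by (auto simp: lookup_add la split: if_splits)
    qed
    \<comment> \<open>An edge not inside \<open>T\<close> avoids the closed neighbourhood of
      \<open>T\<close>. Independence of \<open>S\<close> and \<open>bS\<close> keep its endpoints
      out of \<open>S\<close>, and then \<open>bS\<close> leaves both uncovered, against
      \<open>cov\<close>.\<close>
    have inT: "{u, v} \<subseteq> T" if uv: "adj u v" "{u, v} \<subseteq> {p, q, r, s}" for u v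
    proof (rule ccontr)
      assume nT: "\<not> ?thesis"
      have "u \<in> T \<or> u \<notin> closed_nbrs G T" "v \<in> T \<or> v \<notin> closed_nbrs G T"
        using supp[of u] supp[of v] uv(2) bT S(1) by auto
      from inside[OF uv(1) this] nT have out: "u \<notin> closed_nbrs G T" "v \<notin> closed_nbrs G T" by auto
      then have "u \<in> S \<or> lookup b u \<noteq> 0" "v \<in> S \<or> lookup b v \<noteq> 0"
        using supp[of u] supp[of v] uv(2) by (auto simp: mem_closed_nbrs_iff)
      then have "u \<notin> S" "v \<notin> S" "lookup b u \<noteq> 0" "lookup b v \<noteq> 0"
        using uv(1) adj_sym[OF uv(1)] bS S(2) unfolding indep_iff by blast+
      then have "u \<notin> closed_nbrs G S" "v \<notin> closed_nbrs G S" using bS by (auto simp: mem_closed_nbrs_iff)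
      with cov[OF uv(1)] out show False by blast
    qed
    have sub: "{p, q, r, s} \<subseteq> T" using inT[OF e(1)] inT[OF e(2)] by auto
    have "lookup b u = 0" if "u \<in> T" for u using bT[of u] that by (auto simp: mem_closed_nbrs_iff)
    then have "of_bool (u = p) + of_bool (u = q) + of_bool (u = r) + of_bool (u = s) \<le> (1::nat)" if "u \<in> T" for u
      using le[of u] that by (simp add: lookup_add la)
    from triangle_edge_pair_false[OF T e sub this] show False .
  qed
  have na: "a \<notin> edge_pair_exps G"
  proof
    assume "a \<in> edge_pair_exps G"
    then have "a + 0 \<in> edge_pair_exps G" by simp
    from prime[OF this] show False by simp
  qed
  have "a \<in> cover_exps G"
    unfolding cover_exps_def
  proof (intro CollectI allI impI)
    fix W assume "maxind W"
    then have indW: "indep W" by (rule maxind_indep)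
    \<comment> \<open>An independent set misses at least two vertices of a triangle.\<close>
    have "i \<notin> W \<or> j \<notin> W" if "adj i j" for i j using indW that by (auto simp: indep_iff)
    from this[OF xyz(2)] this[OF xyz(3)] this[OF xyz(4)]
    consider "x \<notin> W" "y \<notin> W" | "y \<notin> W" "z \<notin> W" | "x \<notin> W" "z \<notin> W" by blast
    then obtain u v where uv: "u \<noteq> v" "{u, v} \<subseteq> - W \<inter> (T \<union> S)"
    proof cases
      case 1
      with adj_neq[OF xyz(2)] xyz(1) that[of x y] show thesis by simp
    next
      case 2
      with adj_neq[OF xyz(3)] xyz(1) that[of y z] show thesis by simp
    next
      case 3
      with adj_neq[OF xyz(4)] xyz(1) that[of x z] show thesis by simp
    qed
    have "card {u, v} \<le> card (- W \<inter> (T \<union> S))" using uv(2) by (intro card_mono) auto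
    with uv(1) show "2 \<le> cdeg (- W) a" by (simp add: a_def cdeg_indicator_exp)
  qed
  moreover have "vprime (edge_pair_exps G) a" using na prime by (simp add: vprime_def)
  moreover have "cdeg UNIV a = card S + 3"
  proof -
    have "card (T \<union> S) = card T + card S" using ST by (intro card_Un_disjoint) auto
    then show ?thesis using T by (simp add: a_def cdeg_indicator_exp triangle_def)
  qed
  ultimately show ?thesis by blast
qed

end

section \<open>The v-numbers of the two squares and their comparison\<close>

theorem theorem4p7:
  fixes G :: "'v::finite ugraph" and I :: "('v, 'k::field) mpoly set"
  assumes "simple_graph G" and "vertices G = UNIV" and "edges G \<noteq> {}"
    and "I = edge_ideal G"
  shows
    "v_number_ideal (symbolic_power I 2)
       = enat (Min {card S + 1 + p_ind G S | S. v_witness G S})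
     \<and>
     v_number_ideal (ideal_power mpoly_ring I 2)
       = min (v_number_ideal (symbolic_power I 2))
             (v_number mpoly_ring (ideal_quot (symbolic_power I 2) (ideal_power mpoly_ring I 2)))
     \<and>
     (v_number_ideal (ideal_power mpoly_ring I 2) < v_number_ideal (symbolic_power I 2) \<longleftrightarrow>
       (\<exists>T S'. triangle G T \<and> v_witness (delete_vertices G (closed_nbrs G T)) S' \<and>
          \<not> (\<exists>S. v_witness G S \<and> card S \<le> card S' + 1) \<and>
          (\<forall>S. v_witness G S \<and> card S = card S' + 2 \<longrightarrow> two_packing G S)))"
proof -
  interpret full_graph G using assms(1,2) by unfold_locales
  define C where "C = {enat (cdeg UNIV a) | a. vprime (cover_exps G) a}"
  define E where "E = {enat (cdeg UNIV a) | a. vprime (edge_pair_exps G) a}"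
  define M where "M = {enat (cdeg UNIV a) | a. a \<in> cover_exps G \<and> vprime (edge_pair_exps G) a}"
  define N where "N = {card S + 1 + p_ind G S | S. v_witness G S}"
  have vC: "v_number_ideal (symbolic_power I 2) = Inf C"
    using v_number_monomial_quot[OF up_closed_cover_exps, of UNIV, where 'k = 'k]
    by (simp add: assms(4) v_number_ideal_def symbolic_square_edge_ideal C_def)
  have vE: "v_number_ideal (ideal_power mpoly_ring I 2) = Inf E"
    using v_number_monomial_quot[OF up_closed_edge_pair_exps, of UNIV, where 'k = 'k]
    by (simp add: assms(4) v_number_ideal_def edge_ideal_power_2 E_def)
  have vM: "v_number mpoly_ring (ideal_quot (symbolic_power I 2) (ideal_power mpoly_ring I 2)) = Inf M"
    using v_number_monomial_quot[OF up_closed_edge_pair_exps, of "cover_exps G", where 'k = 'k]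
    by (simp add: assms(4) symbolic_square_edge_ideal edge_ideal_power_2 M_def)
  have "N = (\<lambda>S. card S + 1 + p_ind G S) ` Collect (v_witness G)" by (auto simp: N_def)
  then have finN: "finite N" by simp
  obtain W where "maxind W" using maxind_extend[of "{}"] by (auto simp: indep_iff)
  \<comment> \<open>Maximality leaves no vertex outside \<open>closed_nbrs G W\<close>, so a
    v-witness exists and \<open>Min N\<close> is attained.\<close>
  then have "v_witness G W"
    unfolding v_witness_iff mem_closed_nbrs_iff using maxind_indep maxind_nbr by metis
  then have neN: "N \<noteq> {}" by (auto simp: N_def)
  \<comment> \<open>One monomial of degree \<open>n\<close> serves both ideals; this makes the
    v-number of I^2 at most that of I^(2).\<close>
  have C_le: "\<exists>a. vprime (cover_exps G) a \<and> vprime (edge_pair_exps G) a \<and> cdeg UNIV a = n" if "n \<in> N" for n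
    using that witness_imp_vprime[OF _ assms(3)] vprime_edge_pair_exps_imp_cover_exps
    unfolding N_def by blast
  have le_C: "\<exists>n\<in>N. n \<le> cdeg UNIV a" if "vprime (cover_exps G) a" for a
    using vprime_cover_exps_imp_witness[OF assms(3) that] unfolding N_def by blast
  have C: "Inf C = enat (Min N)"
  proof (rule antisym)
    obtain a where "vprime (cover_exps G) a" "cdeg UNIV a = Min N"
      using C_le[OF Min_in[OF finN neN]] by blast
    then have "enat (Min N) \<in> C" unfolding C_def by (metis (mono_tags, lifting) mem_Collect_eq)
    then show "Inf C \<le> enat (Min N)" by (rule Inf_lower)
    show "enat (Min N) \<le> Inf C"
    proof (rule Inf_greatest)
      fix x assume "x \<in> C"
      then obtain a where a: "x = enat (cdeg UNIV a)" "vprime (cover_exps G) a" by (auto simp: C_def)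
      obtain n where "n \<in> N" "n \<le> cdeg UNIV a" using le_C[OF a(2)] by blast
      then show "enat (Min N) \<le> x" using Min_le[OF finN, of n] by (simp add: a(1))
    qed
  qed
  have E: "Inf E = min (Inf C) (Inf M)"
  proof (rule antisym)
    obtain a where "vprime (edge_pair_exps G) a" "cdeg UNIV a = Min N"
      using C_le[OF Min_in[OF finN neN]] by blast
    then have "enat (Min N) \<in> E" unfolding E_def by (metis (mono_tags, lifting) mem_Collect_eq)
    then have "Inf E \<le> Inf C" unfolding C by (rule Inf_lower)
    moreover have "Inf E \<le> Inf M" by (rule Inf_superset_mono) (auto simp: E_def M_def)
    ultimately show "Inf E \<le> min (Inf C) (Inf M)" by simp
    show "min (Inf C) (Inf M) \<le> Inf E"
    proof (rule Inf_greatest)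
      fix x assume "x \<in> E"
      then obtain a where a: "x = enat (cdeg UNIV a)" "vprime (edge_pair_exps G) a" by (auto simp: E_def)
      then have "x \<in> M \<or> x \<in> C"
        using vprime_edge_pair_exps_imp_cover_exps unfolding M_def C_def by blast
      then show "min (Inf C) (Inf M) \<le> x" by (auto simp: min_le_iff_disj intro: Inf_lower)
    qed
  qed
  have M: "Inf M < Inf C \<longleftrightarrow> (\<exists>T S'. triangle G T \<and>
      v_witness (delete_vertices G (closed_nbrs G T)) S' \<and> (\<forall>n\<in>N. card S' + 3 < n))" (is "_ \<longleftrightarrow> ?R")
  proof
    assume "Inf M < Inf C"
    then obtain a where a: "a \<in> cover_exps G" "vprime (edge_pair_exps G) a" "cdeg UNIV a < Min N"
      unfolding C Inf_less_iff M_def by auto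
    obtain T S' where "triangle G T" "v_witness (delete_vertices G (closed_nbrs G T)) S'"
      and "card S' + 3 \<le> cdeg UNIV a" using vprime_triangle_witness[OF a(2,1)] by blast
    moreover have "cdeg UNIV a < n" if "n \<in> N" for n using a(3) Min_le[OF finN that] by simp
    ultimately show ?R by (meson le_less_trans)
  next
    assume ?R
    then obtain T S' where TS: "triangle G T" "v_witness (delete_vertices G (closed_nbrs G T)) S'"
      and less: "\<forall>n\<in>N. card S' + 3 < n" by blast
    from triangle_witness_imp_vprime[OF TS] have "enat (card S' + 3) \<in> M"
      unfolding M_def by (metis (mono_tags, lifting) mem_Collect_eq)
    moreover have "enat (card S' + 3) < Inf C" unfolding C using less Min_in[OF finN neN] by simp
    ultimately show "Inf M < Inf C" unfolding Inf_less_iff by blast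
  qed
  have N: "(\<forall>n\<in>N. m + 3 < n) \<longleftrightarrow> \<not> (\<exists>S. v_witness G S \<and> card S \<le> m + 1) \<and>
      (\<forall>S. v_witness G S \<and> card S = m + 2 \<longrightarrow> two_packing G S)" for m
  proof -
    have "(\<forall>n\<in>N. m + 3 < n) \<longleftrightarrow> (\<forall>S. v_witness G S \<longrightarrow> m + 3 < card S + 1 + p_ind G S)"
      by (auto simp: N_def)
    also have "\<dots> \<longleftrightarrow> (\<forall>S. v_witness G S \<longrightarrow> \<not> card S \<le> m + 1 \<and> (card S = m + 2 \<longrightarrow> two_packing G S))"
      \<comment> \<open>A witness of size at most \<open>m + 1\<close> contributes at most
        \<open>m + 3\<close>, one of size \<open>m + 2\<close> contributes \<open>m + 3\<close> plus
        its value of \<open>p_ind\<close>, and larger ones always exceed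
        \<open>m + 3\<close>.\<close>
      by (intro all_cong1 imp_cong refl) (auto simp: p_ind_def two_packing_def)
    finally show ?thesis by blast
  qed
  have "v_number_ideal (ideal_power mpoly_ring I 2) < v_number_ideal (symbolic_power I 2) \<longleftrightarrow> Inf M < Inf C"
    unfolding vC vE E by (simp add: min_less_iff_disj)
  then show ?thesis
    unfolding M N using vC vE vM C E by (simp add: N_def)
qed

end
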